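(* Let $\mathcal{A}$ be a unital $C^\ast$-algebra with a faithful tracial positive linear functional $\tau$, and let $\mathcal{A}_+$ be its positive cone. Then for every real $p>0$ and all $A,B\in\mathcal{A}_+$, $$\tau\Bigl(\bigl(A^{p/4}B^{p/2}A^{p/4}\bigr)^{1/p}\Bigr)\le \sqrt{\tau(A)\,\tau(B)}\le \tau\Bigl(\frac{A+B}{2}\Bigr).$$ In particular, for all $p>0$ and all $A,B\in\mathcal{A}_+$, $$\tau\Bigl(\frac{A+B}{2}-\bigl(A^{p/4}B^{p/2}A^{p/4}\bigr)^{1/p}\Bigr)\ge 0.$$
   Context: $\mathcal{A}_+$ denotes the set of positive elements of $\mathcal{A}$. For $X\in\mathcal{A}_+$ and $s>0$, the power $X^s$ is defined by the continuous functional calculus applied to the function $t\mapsto t^s$ on $[0,\infty)$. A tracial positive linear functional is a linear functional $\tau:\mathcal{A}\to\mathbb{C}$ with $\tau(X)\ge 0$ for $X\in\mathcal{A}_+$ and $\tau(XY)=\tau(YX)$ for all $X,Y\in\mathcal{A}$; it is faithful if $X\in\mathcal{A}_+$ and $\tau(X)=0$ imply $X=0$. It is not assumed to be normalized. *)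

theory Defs
  imports "HOL-Analysis.Analysis" "HOL-Library.Complex_Order"
    "HOL-Computational_Algebra.Polynomial"
begin

text \<open>
  Unital \<open>C\<^sup>*\<close>-algebras as a type class. The unit is provided by \<^class>\<open>monoid_mult\<close>
  rather than \<^class>\<open>real_normed_algebra_1\<close>, so that the zero algebra is not excluded;
  if \<open>1 \<noteq> 0\<close>, then \<open>norm 1 = 1\<close> follows from the \<open>C\<^sup>*\<close>-identity.
  Completeness comes from \<^class>\<open>banach\<close>.
\<close>

class cstar_algebra = banach + real_normed_algebra + monoid_mult +
  fixes scaleC :: "complex \<Rightarrow> 'a \<Rightarrow> 'a" (infixr "*\<^sub>C" 75)
    and star :: "'a \<Rightarrow> 'a"
  assumes scaleC_add_right: "c *\<^sub>C (x + y) = c *\<^sub>C x + c *\<^sub>C y"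
    and scaleC_add_left: "(c + d) *\<^sub>C x = c *\<^sub>C x + d *\<^sub>C x"
    and scaleC_scaleC: "c *\<^sub>C (d *\<^sub>C x) = (c * d) *\<^sub>C x"
    and scaleC_one: "1 *\<^sub>C x = x"
    and scaleR_scaleC: "r *\<^sub>R x = complex_of_real r *\<^sub>C x"
    and norm_scaleC: "norm (c *\<^sub>C x) = cmod c * norm x"
    and mult_scaleC_left: "(c *\<^sub>C x) * y = c *\<^sub>C (x * y)"
    and mult_scaleC_right: "x * (c *\<^sub>C y) = c *\<^sub>C (x * y)"
    and star_add: "star (x + y) = star x + star y"
    and star_scaleC: "star (c *\<^sub>C x) = cnj c *\<^sub>C star x"
    and star_mult: "star (x * y) = star y * star x"
    and star_star: "star (star x) = x"
    and cstar_identity: "norm (star x * x) = (norm x)\<^sup>2"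

definition spectrum :: "'a::cstar_algebra \<Rightarrow> complex set" where
  "spectrum x = {z. \<not> (\<exists>y. (z *\<^sub>C 1 - x) * y = 1 \<and> y * (z *\<^sub>C 1 - x) = 1)}"

definition selfadjoint :: "'a::cstar_algebra \<Rightarrow> bool" where
  "selfadjoint x \<longleftrightarrow> star x = x"

text \<open>On \<^typ>\<open>complex\<close>, \<open>0 \<le> z\<close> means that \<open>z\<close> is real and nonnegative.\<close>

definition positive_cone :: "'a::cstar_algebra set" where
  "positive_cone = {x. selfadjoint x \<and> (\<forall>z\<in>spectrum x. 0 \<le> z)}"

definition poly_at :: "real poly \<Rightarrow> 'a::cstar_algebra \<Rightarrow> 'a" where
  "poly_at q x = (\<Sum>i\<le>degree q. coeff q i *\<^sub>R x ^ i)"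

text \<open>
  The continuous functional calculus of a selfadjoint element \<open>x\<close> at a real function \<open>f\<close>
  continuous on the (real, compact) spectrum of \<open>x\<close>: the common limit of \<open>q\<^sub>n(x)\<close> over all
  sequences of polynomials \<open>q\<^sub>n\<close> converging to \<open>f\<close> uniformly on the spectrum.
  The value is only meaningful for such \<open>x\<close> and \<open>f\<close>.
\<close>

definition cfc :: "(real \<Rightarrow> real) \<Rightarrow> 'a::cstar_algebra \<Rightarrow> 'a" where
  "cfc f x = (THE y. \<forall>q :: nat \<Rightarrow> real poly.
     uniform_limit {t. complex_of_real t \<in> spectrum x} (\<lambda>n. poly (q n)) f sequentially
       \<longrightarrow> (\<lambda>n. poly_at (q n) x) \<longlonglongrightarrow> y)"

text \<open>
  Since \<open>0 powr s = 0\<close>, the function \<open>\<lambda>t. t powr s\<close> is \<open>t \<mapsto> t\<^sup>s\<close>, continuous on all of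
  \<open>[0,\<infinity>)\<close>, for \<open>s > 0\<close>.
\<close>

definition cpowr :: "'a::cstar_algebra \<Rightarrow> real \<Rightarrow> 'a" where
  "cpowr x s = cfc (\<lambda>t. t powr s) x"

definition tracial_positive_functional :: "('a::cstar_algebra \<Rightarrow> complex) \<Rightarrow> bool" where
  "tracial_positive_functional \<tau> \<longleftrightarrow>
     (\<forall>x y. \<tau> (x + y) = \<tau> x + \<tau> y) \<and>
     (\<forall>c x. \<tau> (c *\<^sub>C x) = c * \<tau> x) \<and>
     (\<forall>x\<in>positive_cone. 0 \<le> \<tau> x) \<and>
     (\<forall>x y. \<tau> (x * y) = \<tau> (y * x))"

definition faithful_functional :: "('a::cstar_algebra \<Rightarrow> complex) \<Rightarrow> bool" where
  "faithful_functional \<tau> \<longleftrightarrow> (\<forall>x\<in>positive_cone. \<tau> x = 0 \<longrightarrow> x = 0)"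

end

theory Submission
  imports Defs "HOL-Computational_Algebra.Fundamental_Theorem_Algebra"
begin

text \<open>
  Write \<open>t = Re \<circ> \<tau>\<close> and let \<open>A\<close>, \<open>B\<close> be positive and invertible. By the Cauchy--Schwarz
  inequality \<open>u \<mapsto> t (A\<^sup>u B\<^bsup>1-u\<^esup>)\<close> is midpoint convex, hence convex on all of \<open>\<real>\<close>. On \<open>[0,1]\<close> this is
  Young's inequality; for \<open>u \<ge> 1\<close> it is a reverse Young inequality, which amounts to the tangent
  estimate \<open>t (M\<^sup>s) \<le> s t (M C\<^bsup>s-1\<^esup>) + (1 - s) t (C\<^sup>s)\<close> for \<open>0 < s \<le> 1\<close>.

  The weighted statement \<open>(a + b) t ((A\<^bsup>a/2\<^esup> B\<^sup>b A\<^bsup>a/2\<^esup>)\<^bsup>1/(a+b)\<^esup>) \<le> a t (A) + b t (B)\<close> follows from the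
  tangent estimate with \<open>C = A\<^bsup>a+b\<^esup>\<close> if \<open>b \<le> 1 \<le> a + b\<close>; another choice of \<open>C\<close> reduces \<open>b\<close> to \<open>b - 1\<close>;
  and \<open>a + b < 1\<close> is reduced to exponents with sum at least 1 by duality. For \<open>a = b = p/2\<close> this is
  the bound by the arithmetic mean, first for invertible and then by continuity for all positive
  elements; replacing \<open>(A, B)\<close> by \<open>(c A, B / c)\<close> and optimizing over \<open>c\<close> gives the geometric mean.
\<close>

section \<open>Invertible elements and the spectrum\<close>

definition regular :: "'a::monoid_mult \<Rightarrow> bool" where
  "regular x \<longleftrightarrow> (\<exists>y. x * y = 1 \<and> y * x = 1)"

lemma regularI: "x * y = 1 \<Longrightarrow> y * x = 1 \<Longrightarrow> regular x"
  unfolding regular_def by blast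

lemma regular_one: "regular 1"
  by (rule regularI[of _ 1]) simp_all

lemma regular_mult:
  assumes "regular x" "regular y"
  shows "regular (x * y)"
proof -
  obtain x' y' where *: "x * x' = 1" "x' * x = 1" "y * y' = 1" "y' * y = 1"
    using assms unfolding regular_def by blast
  have "x * y * (y' * x') = x * (y * y') * x'" "y' * x' * (x * y) = y' * (x' * x) * y"
    by (simp_all only: mult.assoc)
  with * show ?thesis by (intro regularI[of _ "y' * x'"]) simp_all
qed

lemma in_spectrum_iff: "z \<in> spectrum x \<longleftrightarrow> \<not> regular (z *\<^sub>C 1 - x)"
  unfolding spectrum_def regular_def by simp

lemma scaleC_zero_left [simp]: "0 *\<^sub>C x = 0" for x :: "'a::cstar_algebra"
  using scaleR_scaleC[of 0 x] by (simp only: scaleR_zero_left of_real_0)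

lemma scaleC_minus_left: "(- c) *\<^sub>C x = - (c *\<^sub>C x)" for x :: "'a::cstar_algebra"
  using scaleC_add_left[of "- c" c x] by (simp add: eq_neg_iff_add_eq_0)

lemma scaleC_diff_left: "(c - d) *\<^sub>C x = c *\<^sub>C x - d *\<^sub>C x" for x :: "'a::cstar_algebra"
  using scaleC_add_left[of c "- d" x] by (simp add: scaleC_minus_left)

lemma scaleC_zero_right [simp]: "c *\<^sub>C 0 = (0 :: 'a::cstar_algebra)"
  using scaleC_add_right[of c "0 :: 'a" 0] by simp

lemma scaleC_minus_right: "c *\<^sub>C (- x) = - (c *\<^sub>C x)" for x :: "'a::cstar_algebra"
  using scaleC_add_right[of c "- x" x] by (simp add: eq_neg_iff_add_eq_0)

lemma scaleC_diff_right: "c *\<^sub>C (x - y) = c *\<^sub>C x - c *\<^sub>C y" for x :: "'a::cstar_algebra"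
  using scaleC_add_right[of c x "- y"] by (simp add: scaleC_minus_right)

lemma star_one [simp]: "star 1 = (1 :: 'a::cstar_algebra)"
  by (metis mult_1_left mult_1_right star_mult star_star)

lemma star_zero [simp]: "star 0 = (0 :: 'a::cstar_algebra)"
  using star_add[of "0 :: 'a" 0] by simp

lemma star_minus: "star (- x) = - star x" for x :: "'a::cstar_algebra"
  using star_add[of "- x" x] by (simp add: eq_neg_iff_add_eq_0)

lemma star_diff: "star (x - y) = star x - star y" for x :: "'a::cstar_algebra"
  using star_add[of x "- y"] by (simp add: star_minus)

lemma star_scaleR: "star (r *\<^sub>R x) = r *\<^sub>R star x" for x :: "'a::cstar_algebra"
  by (simp add: scaleR_scaleC star_scaleC)

lemma star_power: "star (x ^ n) = star x ^ n" for x :: "'a::cstar_algebra"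
  by (induction n) (simp_all add: star_mult power_commutes)

text \<open>The C*-identity and submultiplicativity give
  \<open>norm y * norm y \<le> norm (star y) * norm y\<close>. Cancel \<open>norm y\<close> and
  apply the result to \<open>x\<close> and to \<open>star x\<close>.\<close>

lemma norm_star [simp]: "norm (star x) = norm x" for x :: "'a::cstar_algebra"
proof -
  have *: "norm y \<le> norm (star y)" for y :: 'a
  proof (cases "norm y = 0")
    case False
    have "norm y * norm y \<le> norm (star y) * norm y"
      using cstar_identity[of y] norm_mult_ineq[of "star y" y] by (simp add: power2_eq_square)
    with False show ?thesis
      by (metis mult_right_le_imp_le norm_ge_zero order_le_less)
  qed simp
  show ?thesis using *[of x] *[of "star x"] by (simp add: star_star)
qed

text \<open>The C*-identity at 1 says that the norm of 1 equals its own square, so it is 0 or 1; the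
  value 0 occurs in the zero algebra.\<close>

lemma norm_one_le: "norm (1 :: 'a::cstar_algebra) \<le> 1"
  using cstar_identity[of "1 :: 'a"] by (auto simp: power2_eq_square)

lemma norm_power_le: "norm (x ^ n) \<le> norm x ^ n" for x :: "'a::cstar_algebra"
proof (induction n)
  case (Suc n)
  have "norm (x ^ Suc n) \<le> norm x * norm (x ^ n)" by (simp add: norm_mult_ineq)
  also have "\<dots> \<le> norm x * norm x ^ n" by (intro mult_left_mono Suc) simp
  finally show ?case by simp
qed (simp add: norm_one_le)

lemma bounded_linear_star: "bounded_linear (star :: 'a::cstar_algebra \<Rightarrow> 'a)"
  by (rule bounded_linear_intro[of _ 1]) (simp_all add: star_add star_scaleR)

lemma scaleC_mult_scaleC: "(c *\<^sub>C x) * (d *\<^sub>C y) = (c * d) *\<^sub>C (x * y)"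
  for x y :: "'a::cstar_algebra"
  by (simp add: mult_scaleC_left mult_scaleC_right scaleC_scaleC mult.commute)

lemma regular_scaleC:
  fixes x :: "'a::cstar_algebra"
  assumes "regular x" "c \<noteq> 0"
  shows "regular (c *\<^sub>C x)"
proof -
  obtain y where "x * y = 1" "y * x = 1" using assms unfolding regular_def by blast
  with assms(2) show ?thesis
    by (intro regularI[of _ "inverse c *\<^sub>C y"]) (simp_all add: scaleC_mult_scaleC scaleC_one)
qed

lemma one_minus_power_eq:
  fixes x :: "'a::cstar_algebra"
  shows "(1 - x) * (\<Sum>k<n. x ^ k) = 1 - x ^ n" "(\<Sum>k<n. x ^ k) * (1 - x) = 1 - x ^ n"
proof (induction n)
  case (Suc n)
  { case 1 show ?case using Suc(1) by (simp add: distrib_left left_diff_distrib diff_eq_eq) (simp add: algebra_simps) }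
  { case 2 show ?case using Suc(2) by (simp add: distrib_right right_diff_distrib power_commutes diff_eq_eq) (simp add: algebra_simps) }
qed auto

text \<open>Neumann series: the geometric series converges by completeness, and its telescoping
  partial sums make it a two-sided inverse in the limit.\<close>

lemma regular_one_minus:
  fixes x :: "'a::cstar_algebra"
  assumes "norm x < 1"
  shows "regular (1 - x)"
proof -
  have "summable (\<lambda>n. x ^ n)"
    by (rule summable_comparison_test'[where g = "\<lambda>n. norm x ^ n" and N = 0])
       (use assms in \<open>auto intro!: norm_power_le\<close>)
  then have S: "(\<lambda>n. \<Sum>k<n. x ^ k) \<longlonglongrightarrow> (\<Sum>k. x ^ k)"
    by (simp add: summable_LIMSEQ)
  have "(\<lambda>n. x ^ n) \<longlonglongrightarrow> 0"
    using \<open>summable (\<lambda>n. x ^ n)\<close> by (rule summable_LIMSEQ_zero)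
  from tendsto_diff[OF tendsto_const[of 1] this]
  have P: "(\<lambda>n. 1 - x ^ n) \<longlonglongrightarrow> 1" by simp
  have "(1 - x) * (\<Sum>k. x ^ k) = 1"
    using LIMSEQ_unique[OF tendsto_mult[OF tendsto_const[of "1 - x"] S]] P
    by (simp add: one_minus_power_eq)
  moreover have "(\<Sum>k. x ^ k) * (1 - x) = 1"
    using LIMSEQ_unique[OF tendsto_mult[OF S tendsto_const[of "1 - x"]]] P
    by (simp add: one_minus_power_eq)
  ultimately show ?thesis by (rule regularI)
qed

text \<open>For \<open>norm x < cmod z\<close> the factorization
  \<open>z 1 - x = z (1 - x / z)\<close> has an invertible second factor by the Neumann
  series.\<close>

lemma spectrum_norm_le:
  fixes x :: "'a::cstar_algebra"
  assumes "z \<in> spectrum x"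
  shows "cmod z \<le> norm x"
proof (rule ccontr)
  assume less: "\<not> cmod z \<le> norm x"
  then have z: "z \<noteq> 0" by auto
  have "norm (inverse z *\<^sub>C x) < 1"
    using less z by (simp add: norm_scaleC norm_inverse divide_inverse [symmetric] mult.commute)
  then have "regular (z *\<^sub>C (1 - inverse z *\<^sub>C x))"
    using z by (intro regular_scaleC regular_one_minus)
  also have "z *\<^sub>C (1 - inverse z *\<^sub>C x) = z *\<^sub>C 1 - x"
    using z by (simp add: scaleC_diff_right scaleC_scaleC scaleC_one)
  finally show False using assms by (simp add: in_spectrum_iff)
qed

text \<open>If \<open>v\<close> inverts \<open>z 1 - x\<close>, then \<open>w 1 - x\<close> is
  \<open>z 1 - x\<close> times a perturbation of 1 by \<open>(z - w) v\<close>, which stays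
  invertible for \<open>w\<close> near \<open>z\<close>.\<close>

lemma closed_spectrum: "closed (spectrum (x :: 'a::cstar_algebra))"
proof -
  have "\<exists>e>0. \<forall>w. dist w z < e \<longrightarrow> w \<notin> spectrum x" if z: "z \<notin> spectrum x" for z
  proof -
    obtain v where v: "(z *\<^sub>C 1 - x) * v = 1" "v * (z *\<^sub>C 1 - x) = 1"
      using z unfolding in_spectrum_iff regular_def by blast
    \<comment> \<open>The summand 1 keeps the radius meaningful when \<open>v = 0\<close>, as in the
      zero algebra.\<close>
    have "w \<notin> spectrum x" if "dist w z < 1 / (norm v + 1)" for w
    proof -
      have "cmod (z - w) * (norm v + 1) < 1"
        using that by (simp add: dist_norm norm_minus_commute pos_less_divide_eq add_nonneg_pos)
      then have "norm ((z - w) *\<^sub>C v) < 1"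
        by (simp add: norm_scaleC) (smt (verit) mult_left_mono norm_ge_zero)
      then have "regular ((z *\<^sub>C 1 - x) * (1 - (z - w) *\<^sub>C v))"
        using v by (intro regular_mult regular_one_minus) (auto simp: regular_def)
      also have "(z *\<^sub>C 1 - x) * (1 - (z - w) *\<^sub>C v) = w *\<^sub>C 1 - x"
        using v by (simp add: right_diff_distrib mult_scaleC_right scaleC_diff_left)
      finally show ?thesis by (simp add: in_spectrum_iff)
    qed
    moreover have "1 / (norm v + 1) > 0" by (simp add: add_nonneg_pos)
    ultimately show ?thesis by blast
  qed
  then have "open (- spectrum x)" unfolding open_dist by auto
  then show ?thesis by (simp add: closed_def)
qed

lemma spectrum_shift: "z \<in> spectrum (x + c *\<^sub>C 1) \<longleftrightarrow> z - c \<in> spectrum x"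
  by (simp add: in_spectrum_iff scaleC_diff_left algebra_simps)

text \<open>Shift by an imaginary multiple of 1: the squared norm grows by at most
  \<open>t\<^sup>2\<close>, whereas the squared modulus of the shifted spectral point also gains
  \<open>2 * Im z * t\<close>, which is unbounded in \<open>t\<close> unless
  \<open>Im z = 0\<close>.\<close>

lemma selfadjoint_spectrum_real:
  assumes "selfadjoint x" "z \<in> spectrum x"
  shows "Im z = 0"
proof (rule ccontr)
  assume b: "Im z \<noteq> 0"
  have *: "(Re z)\<^sup>2 + (Im z)\<^sup>2 + 2 * Im z * t \<le> (norm x)\<^sup>2" for t
  proof -
    define c where "c = \<i> * complex_of_real t"
    have c: "cnj c = - c" "c * c = - (of_real t * of_real t)"
      by (simp_all add: c_def complex_eq_iff)
    have "z + c \<in> spectrum (x + c *\<^sub>C 1)" using assms by (simp add: spectrum_shift)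
    then have "(cmod (z + c))\<^sup>2 \<le> (norm (x + c *\<^sub>C 1))\<^sup>2"
      by (intro power_mono spectrum_norm_le) auto
    also have "\<dots> = norm (star (x + c *\<^sub>C 1) * (x + c *\<^sub>C 1))"
      by (simp add: cstar_identity)
    also have "star (x + c *\<^sub>C 1) * (x + c *\<^sub>C 1) = x * x + t\<^sup>2 *\<^sub>R 1"
      using assms(1)
      by (simp add: selfadjoint_def star_add star_scaleC c distrib_left distrib_right left_diff_distrib
          scaleC_minus_left scaleC_minus_right scaleC_diff_right scaleC_add_right
          mult_scaleC_left mult_scaleC_right scaleC_scaleC scaleR_scaleC power2_eq_square)
    also have "norm (x * x + t\<^sup>2 *\<^sub>R 1) \<le> (norm x)\<^sup>2 + t\<^sup>2 * 1"
      using norm_triangle_ineq[of "x * x" "t\<^sup>2 *\<^sub>R 1"] norm_mult_ineq[of x x]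
        mult_left_mono[OF norm_one_le[where 'a = 'a], of "t\<^sup>2"]
      by (simp add: power2_eq_square)
    finally show ?thesis
      by (simp add: cmod_power2 c_def power2_sum)
  qed
  show False
    \<comment> \<open>This \<open>t\<close> makes the linear term equal to
      \<open>(norm x)\<^sup>2 + 1\<close>, which is too large.\<close>
    using *[of "((norm x)\<^sup>2 + 1) / (2 * Im z)"] b zero_le_power2[of "Re z"] zero_le_power2[of "Im z"]
    by simp
qed

section \<open>The norm of a selfadjoint element\<close>

lemma selfadjoint_add: "selfadjoint x \<Longrightarrow> selfadjoint y \<Longrightarrow> selfadjoint (x + y)"
  by (simp add: selfadjoint_def star_add)

lemma selfadjoint_diff: "selfadjoint x \<Longrightarrow> selfadjoint y \<Longrightarrow> selfadjoint (x - y)"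
  by (simp add: selfadjoint_def star_diff)

lemma selfadjoint_one: "selfadjoint 1"
  by (simp add: selfadjoint_def)

lemma selfadjoint_scaleR: "selfadjoint x \<Longrightarrow> selfadjoint (r *\<^sub>R x)"
  by (simp add: selfadjoint_def star_scaleR)

lemma selfadjoint_power: "selfadjoint x \<Longrightarrow> selfadjoint (x ^ n)"
  by (simp add: selfadjoint_def star_power)

text \<open>As \<open>a\<close> and \<open>b\<close> commute, \<open>u = a + \<i> b\<close> is
  normal. Hence \<open>u d\<close> and \<open>star u d\<close> have equal norm by the C*-identity,
  and their difference is \<open>2 \<i> b d\<close>.\<close>

lemma norm_mult_imaginary_part_le:
  fixes a b d :: "'a::cstar_algebra"
  assumes "selfadjoint a" "selfadjoint b" "a * b = b * a"
  shows "norm (b * d) \<le> norm ((a + \<i> *\<^sub>C b) * d)"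
proof -
  define u where "u = a + \<i> *\<^sub>C b"
  define v where "v = a - \<i> *\<^sub>C b"
  have uv: "star u = v" "star v = u"
    using assms by (simp_all add: u_def v_def star_add star_diff star_scaleC selfadjoint_def
        scaleC_minus_left)
  have "v * u = u * v"
    using assms(3)
    by (simp add: u_def v_def distrib_left distrib_right right_diff_distrib left_diff_distrib
        mult_scaleC_left mult_scaleC_right scaleC_diff_right scaleC_add_right)
  then have "star (u * d) * (u * d) = star (v * d) * (v * d)"
    by (simp add: star_mult uv mult.assoc) (simp add: mult.assoc [symmetric])
  then have "(norm (u * d))\<^sup>2 = (norm (v * d))\<^sup>2"
    by (simp add: cstar_identity [symmetric])
  then have eq: "norm (u * d) = norm (v * d)" by simp
  have "(2 * \<i>) *\<^sub>C (b * d) = u * d - v * d"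
    by (simp add: u_def v_def algebra_simps mult_scaleC_left flip: scaleC_add_left)
  then have "2 * norm (b * d) = norm (u * d - v * d)"
    by (metis norm_scaleC norm_mult norm_ii mult.right_neutral norm_numeral)
  also have "\<dots> \<le> norm (u * d) + norm (v * d)" by (rule norm_triangle_ineq4)
  finally show ?thesis using eq by (simp add: u_def)
qed

lemma norm_selfadjoint_power2:
  assumes "selfadjoint y"
  shows "norm (y ^ (2 ^ n)) = norm y ^ (2 ^ n)"
proof (induction n)
  case (Suc n)
  have "norm (y ^ (2 ^ Suc n)) = norm (star (y ^ 2 ^ n) * y ^ 2 ^ n)"
    using assms by (simp add: star_power selfadjoint_def power_add [symmetric] mult_2)
  also have "\<dots> = (norm y ^ (2 ^ n))\<^sup>2" by (simp add: cstar_identity Suc)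
  finally show ?case by (simp add: power_mult [symmetric] mult.commute)
qed simp

text \<open>
  For real \<open>s\<close> one has \<open>1 + s\<^sup>4 = \<bar>(1 - s\<^sup>2) + \<i> \<surd>2 s\<bar>\<^sup>2\<close>, with imaginary part at least
  \<open>\<surd>2 s\<close>. Taking \<open>s = y ^ (2 ^ m)\<close>, the product \<open>d\<close> of these factors has norm at least
  \<open>(\<surd>2) ^ m\<close>, while the telescoping identity bounds \<open>star d * d\<close> if \<open>1 - y ^ 4\<close> is invertible.
\<close>

lemma not_regular_one_minus_power4:
  fixes y :: "'a::cstar_algebra"
  assumes sa: "selfadjoint y" and n1: "norm y = 1"
  shows "\<not> regular (1 - y ^ 4)"
proof
  assume "regular (1 - y ^ 4)"
  then obtain v where v: "(1 - y ^ 4) * v = 1" unfolding regular_def by blast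
  \<comment> \<open>The lower bound carries an arbitrary right factor \<open>c\<close> because the
    induction step applies it to \<open>s * c\<close>.\<close>
  have ex: "\<exists>d. d * y = y * d
      \<and> (\<forall>c. sqrt 2 ^ m * norm (y ^ (2 ^ m - 1) * c) \<le> norm (d * c))
      \<and> star d * d * (1 - y ^ 4) = 1 - y ^ (2 ^ (m + 2))" for m
  proof (induction m)
    case 0
    show ?case by (rule exI[of _ 1]) simp
  next
    case (Suc m)
    then obtain d where d: "d * y = y * d"
        "\<And>c. sqrt 2 ^ m * norm (y ^ (2 ^ m - 1) * c) \<le> norm (d * c)"
        "star d * d * (1 - y ^ 4) = 1 - y ^ (2 ^ (m + 2))"
      by blast
    define s where "s = y ^ (2 ^ m)"
    define u where "u = (1 - s ^ 2) + \<i> *\<^sub>C (sqrt 2 *\<^sub>R s)"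
    have sas: "selfadjoint s" using sa by (simp add: s_def selfadjoint_power)
    have pc: "d * y ^ k = y ^ k * d" for k
    proof (induction k)
      case (Suc k)
      have "d * y ^ Suc k = d * y * y ^ k" by (simp add: mult.assoc)
      also have "\<dots> = y * (d * y ^ k)" by (simp add: d(1) mult.assoc)
      finally show ?case by (simp add: Suc mult.assoc)
    qed simp
    have sd: "d * s = s * d" by (simp add: s_def pc)
    have sy: "s * y = y * s" by (simp add: s_def power_commutes)
    have uy: "u * y = y * u"
      by (simp add: u_def power2_eq_square distrib_left distrib_right right_diff_distrib
          left_diff_distrib mult_scaleC_left mult_scaleC_right mult.assoc sy)
         (simp add: mult.assoc [symmetric] sy)
    have s4: "s ^ 4 = y ^ (2 ^ (m + 2))" by (simp add: s_def power_mult [symmetric] mult.commute)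
    have uu: "star u * u = 1 + s ^ 4"
    proof -
      define c where "c = \<i> * complex_of_real (sqrt 2)"
      have c: "cnj c = - c" "c * c = - 2"
        by (simp_all add: c_def complex_eq_iff)
      have u: "u = (1 - s * s) + c *\<^sub>C s"
        by (simp add: u_def c_def scaleR_scaleC scaleC_scaleC power2_eq_square)
      have "star u * u = (1 - s * s) * (1 - s * s) + 2 *\<^sub>C (s * s)"
        using sas
        by (simp add: u selfadjoint_def star_add star_diff star_mult star_scaleC c distrib_left
            right_diff_distrib left_diff_distrib mult_scaleC_left mult_scaleC_right scaleC_scaleC
            mult.assoc scaleC_minus_left scaleC_diff_right)
      also have "2 *\<^sub>C (s * s) = 2 *\<^sub>R (s * s)" by (simp add: scaleR_scaleC)
      also have "(1 - s * s) * (1 - s * s) + 2 *\<^sub>R (s * s) = 1 + s ^ 4"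
        by (simp add: power2_eq_square eval_nat_numeral distrib_left right_diff_distrib
          left_diff_distrib mult.assoc scaleR_2)
      finally show ?thesis .
    qed
    have "sqrt 2 ^ Suc m * norm (y ^ (2 ^ Suc m - 1) * c) \<le> norm (u * d * c)" for c
    proof -
      have "y ^ (2 ^ Suc m - 1) = y ^ (2 ^ m - 1) * s"
        by (simp add: s_def power_add [symmetric] mult_2)
      then have "sqrt 2 ^ Suc m * norm (y ^ (2 ^ Suc m - 1) * c)
          = sqrt 2 * (sqrt 2 ^ m * norm (y ^ (2 ^ m - 1) * (s * c)))"
        by (simp add: mult.assoc)
      also have "\<dots> \<le> sqrt 2 * norm (d * (s * c))" by (intro mult_left_mono d(2)) simp
      also have "d * (s * c) = s * (d * c)" by (simp add: mult.assoc [symmetric] sd)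
      also have "sqrt 2 * norm (s * (d * c)) = norm ((sqrt 2 *\<^sub>R s) * (d * c))" by simp
      also have "\<dots> \<le> norm (u * (d * c))"
        unfolding u_def using sas
        by (intro norm_mult_imaginary_part_le selfadjoint_diff selfadjoint_one
            selfadjoint_power selfadjoint_scaleR)
           (simp_all add: left_diff_distrib right_diff_distrib power_commutes scaleR_diff_right)
      finally show ?thesis by (simp add: mult.assoc)
    qed
    moreover have "u * d * y = y * (u * d)"
      by (simp add: mult.assoc d(1)) (simp add: mult.assoc [symmetric] uy)
    moreover have "star (u * d) * (u * d) * (1 - y ^ 4) = 1 - y ^ (2 ^ (Suc m + 2))"
    proof -
      have "star (u * d) * (u * d) * (1 - y ^ 4) = star d * (star u * u) * d * (1 - y ^ 4)"
        by (simp add: star_mult mult.assoc)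
      also have "\<dots> = star d * ((1 + s ^ 4) * d) * (1 - y ^ 4)" by (simp add: uu mult.assoc)
      also have "(1 + s ^ 4) * d = d * (1 + s ^ 4)"
        by (simp add: s4 distrib_left distrib_right pc)
      also have "star d * (d * (1 + s ^ 4)) * (1 - y ^ 4)
          = star d * d * ((1 + s ^ 4) * (1 - y ^ 4))" by (simp add: mult.assoc)
      also have "(1 + s ^ 4) * (1 - y ^ 4) = (1 - y ^ 4) * (1 + s ^ 4)"
        by (simp add: s4 distrib_left distrib_right left_diff_distrib right_diff_distrib
            power_add [symmetric] add.commute)
      also have "star d * d * ((1 - y ^ 4) * (1 + s ^ 4)) = (1 - s ^ 4) * (1 + s ^ 4)"
        by (simp add: d(3) s4 mult.assoc [symmetric])
      also have "\<dots> = 1 - s ^ 4 * s ^ 4"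
        by (simp add: distrib_left left_diff_distrib)
      also have "s ^ 4 * s ^ 4 = y ^ (2 ^ (Suc m + 2))" by (simp add: s4 power_add [symmetric])
      finally show ?thesis .
    qed
    ultimately show ?case by blast
  qed
  have "2 ^ m \<le> 2 * norm v" for m
  proof -
    obtain d where d: "sqrt 2 ^ m * norm (y ^ (2 ^ m - 1) * 1) \<le> norm (d * 1)"
        "star d * d * (1 - y ^ 4) = 1 - y ^ (2 ^ (m + 2))"
      using ex[of m] by blast
    \<comment> \<open>The power with exponent \<open>2 ^ m\<close> has norm exactly 1; splitting off
      one factor \<open>y\<close> of norm 1 bounds the norm of the remaining power from
      below.\<close>
    have "1 = norm (y ^ (2 ^ m - 1) * y)"
      using norm_selfadjoint_power2[OF sa, of m] n1
      by (simp flip: power_Suc2)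
    also have "\<dots> \<le> norm (y ^ (2 ^ m - 1))"
      using norm_mult_ineq[of "y ^ (2 ^ m - 1)" y] n1 by simp
    finally have "sqrt 2 ^ m * 1 \<le> sqrt 2 ^ m * norm (y ^ (2 ^ m - 1))"
      by (intro mult_left_mono) simp_all
    from order_trans[OF this] d(1) have "sqrt 2 ^ m \<le> norm d" by (simp only: mult_1_right)
    then have "(sqrt 2 ^ m)\<^sup>2 \<le> (norm d)\<^sup>2" by (intro power_mono) auto
    also have "(sqrt 2 ^ m)\<^sup>2 = 2 ^ m" by (simp add: power2_eq_square flip: power_mult_distrib)
    also have "(norm d)\<^sup>2 = norm (star d * d * ((1 - y ^ 4) * v))" by (simp add: cstar_identity v)
    also have "\<dots> = norm ((1 - y ^ (2 ^ (m + 2))) * v)"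
      by (simp add: d(2) mult.assoc [symmetric])
    also have "\<dots> \<le> norm (1 - y ^ (2 ^ (m + 2))) * norm v" by (rule norm_mult_ineq)
    also have "\<dots> \<le> 2 * norm v"
    proof (rule mult_right_mono)
      have "norm (1 - y ^ (2 ^ (m + 2))) \<le> norm (1 :: 'a) + norm (y ^ (2 ^ (m + 2)))"
        by (rule norm_triangle_ineq4)
      also have "norm (y ^ (2 ^ (m + 2))) \<le> 1" using norm_power_le[of y "2 ^ (m + 2)"] n1 by simp
      finally show "norm (1 - y ^ (2 ^ (m + 2))) \<le> 2" using norm_one_le[where 'a = 'a] by simp
    qed simp
    finally show ?thesis .
  qed
  moreover obtain m where "2 * norm v < 2 ^ m"
    using real_arch_pow[of 2 "2 * norm v"] by auto
  ultimately show False by (meson not_less)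
qed

text \<open>Scale to \<open>norm y = 1\<close>. The factors of \<open>1 - y ^ 4\<close> belong to
  the points 1, -1, \<open>\<i>\<close> and \<open>- \<i>\<close>. The last two are not spectral
  values since the spectrum is real; if neither of the first two were, \<open>1 - y ^ 4\<close>
  would be invertible. This relates norm and spectrum without the spectral radius formula.\<close>

lemma norm_in_spectrum:
  fixes x :: "'a::cstar_algebra"
  assumes sa: "selfadjoint x" and nz: "x \<noteq> 0"
  obtains t where "complex_of_real t \<in> spectrum x" "\<bar>t\<bar> = norm x"
proof -
  define y where "y = inverse (norm x) *\<^sub>R x"
  have y: "selfadjoint y" "norm y = 1"
    using sa nz by (simp_all add: y_def selfadjoint_scaleR)
  have regc: "regular (z *\<^sub>C 1 - y)" if "complex_of_real (norm x) * z \<notin> spectrum x" for z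
  proof -
    have "regular (complex_of_real (inverse (norm x)) *\<^sub>C ((complex_of_real (norm x) * z) *\<^sub>C 1 - x))"
      using that nz by (intro regular_scaleC) (simp_all add: in_spectrum_iff)
    also have "complex_of_real (inverse (norm x)) *\<^sub>C ((complex_of_real (norm x) * z) *\<^sub>C 1 - x) = z *\<^sub>C 1 - y"
      using nz by (simp add: scaleC_diff_right scaleC_scaleC y_def scaleR_scaleC mult.assoc [symmetric])
    finally show ?thesis .
  qed
  have im: "complex_of_real (norm x) * \<i> \<notin> spectrum x" "complex_of_real (norm x) * (- \<i>) \<notin> spectrum x"
    using selfadjoint_spectrum_real[OF sa] nz by force+
  have False if "complex_of_real (norm x) \<notin> spectrum x" "complex_of_real (- norm x) \<notin> spectrum x"
  proof -
    have "regular ((1 *\<^sub>C 1 - y) * ((-1) *\<^sub>C 1 - y) * ((\<i> *\<^sub>C 1 - y) * ((- \<i>) *\<^sub>C 1 - y)))"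
      using that im by (intro regular_mult regc) simp_all
    also have "(1 *\<^sub>C 1 - y) * ((-1) *\<^sub>C 1 - y) * ((\<i> *\<^sub>C 1 - y) * ((- \<i>) *\<^sub>C 1 - y))
        = - (1 - y * y) * (1 + y * y)"
    proof -
      have "(1 *\<^sub>C 1 - y) * ((-1) *\<^sub>C 1 - y) = - (1 - y * y)"
        by (simp add: scaleC_one scaleC_minus_left distrib_left right_diff_distrib left_diff_distrib)
      moreover have "(\<i> *\<^sub>C 1 - y) * ((- \<i>) *\<^sub>C 1 - y) = 1 + y * y"
        by (simp add: scaleC_one scaleC_minus_left distrib_left right_diff_distrib left_diff_distrib
          mult_scaleC_left mult_scaleC_right scaleC_scaleC scaleC_minus_right scaleC_diff_right)
      ultimately show ?thesis by simp
    qed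
    also have "- (1 - y * y) * (1 + y * y) = (-1) *\<^sub>C (1 - y ^ 4)"
      by (simp add: scaleC_one scaleC_minus_left eval_nat_numeral distrib_left left_diff_distrib mult.assoc)
    finally have "regular ((-1) *\<^sub>C (1 - y ^ 4))" .
    from regular_scaleC[OF this, of "-1"] have "regular ((-1) *\<^sub>C ((-1) *\<^sub>C (1 - y ^ 4)))" by simp
    then have "regular (1 - y ^ 4)" by (simp add: scaleC_minus_left scaleC_one)
    with not_regular_one_minus_power4[OF y] show False by simp
  qed
  then show thesis using that[of "norm x"] that[of "- norm x"] by fastforce
qed

text \<open>In the zero algebra every element is invertible and all spectra are empty, hence the
  condition on 1.\<close>

lemma spectrum_nonempty:
  fixes x :: "'a::cstar_algebra"
  assumes "selfadjoint x" "(1 :: 'a) \<noteq> 0"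
  obtains t where "complex_of_real t \<in> spectrum x"
proof (cases "x = 0")
  case True
  have "complex_of_real 0 \<in> spectrum x"
    using assms(2) by (simp add: True in_spectrum_iff regular_def)
  then show thesis by (rule that)
next
  case False
  then show thesis using norm_in_spectrum[OF assms(1)] that by metis
qed

section \<open>Polynomials in an element\<close>

text \<open>Complex coefficients are introduced because polynomials then split into linear
  factors.\<close>

definition cpoly_at :: "complex poly \<Rightarrow> 'a::cstar_algebra \<Rightarrow> 'a" where
  "cpoly_at q x = (\<Sum>i\<le>degree q. coeff q i *\<^sub>C x ^ i)"

lemma cpoly_at_eq_sum:
  assumes "degree q \<le> n"
  shows "cpoly_at q x = (\<Sum>i\<le>n. coeff q i *\<^sub>C x ^ i)"
  unfolding cpoly_at_def using assms
  by (intro sum.mono_neutral_left) (auto simp: coeff_eq_0)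

lemma cpoly_at_0 [simp]: "cpoly_at 0 x = 0"
  by (simp add: cpoly_at_def)

lemma scaleC_sum_right: "c *\<^sub>C sum f A = (\<Sum>i\<in>A. c *\<^sub>C (f i :: 'a::cstar_algebra))"
  by (induction A rule: infinite_finite_induct) (simp_all add: scaleC_add_right)

lemma cpoly_at_pCons: "cpoly_at (pCons a q) x = a *\<^sub>C 1 + x * cpoly_at q x"
proof -
  have "cpoly_at (pCons a q) x = (\<Sum>i\<le>Suc (degree q). coeff (pCons a q) i *\<^sub>C x ^ i)"
    by (rule cpoly_at_eq_sum) (rule degree_pCons_le)
  also have "\<dots> = a *\<^sub>C 1 + (\<Sum>i\<le>degree q. coeff q i *\<^sub>C x ^ Suc i)"
    by (subst sum.atMost_Suc_shift) simp
  finally show ?thesis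
    by (simp add: cpoly_at_def sum_distrib_left mult_scaleC_right)
qed

lemma cpoly_at_add: "cpoly_at (p + q) x = cpoly_at p x + cpoly_at q x"
proof -
  define n where "n = max (degree p) (degree q)"
  have "degree (p + q) \<le> n" "degree p \<le> n" "degree q \<le> n"
    by (simp_all add: n_def degree_add_le)
  then show ?thesis
    by (simp add: cpoly_at_eq_sum[of _ n] scaleC_add_left sum.distrib)
qed

lemma cpoly_at_smult: "cpoly_at (smult c p) x = c *\<^sub>C cpoly_at p x"
  by (simp add: cpoly_at_eq_sum[of _ "degree p"] scaleC_sum_right scaleC_scaleC degree_smult_le)

lemma cpoly_at_mult: "cpoly_at (p * q) x = cpoly_at p x * cpoly_at q x"
  by (induction p)
     (simp_all add: mult_pCons_left cpoly_at_add cpoly_at_smult cpoly_at_pCons distrib_right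
       mult_scaleC_left mult.assoc)

text \<open>One half of the spectral mapping theorem: split off one root at a time; each linear
  factor is invertible because its root lies outside the spectrum.\<close>

lemma regular_cpoly_at:
  fixes x :: "'a::cstar_algebra"
  assumes "p \<noteq> 0" "\<And>z. poly p z = 0 \<Longrightarrow> z \<notin> spectrum x"
  shows "regular (cpoly_at p x)"
  using assms
proof (induction "degree p" arbitrary: p)
  case 0
  then obtain a where p: "p = [:a:]" by (metis degree_eq_zeroE)
  with 0 have "a \<noteq> 0" by simp
  then show ?case by (simp add: p cpoly_at_pCons regular_scaleC regular_one)
next
  case (Suc n)
  have "\<not> (\<exists>a l. a \<noteq> 0 \<and> l = 0 \<and> p = pCons a l)" using Suc(2) by auto
  then obtain z where z: "poly p z = 0" using fundamental_theorem_of_algebra_alt by blast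
  then have "[:- z, 1:] dvd p" by (simp add: poly_eq_0_iff_dvd)
  then obtain q where q: "p = [:- z, 1:] * q" by (rule dvdE)
  with Suc have "q \<noteq> 0" by auto
  then have "degree p = Suc (degree q)" unfolding q by (subst degree_mult_eq) auto
  then have "regular (cpoly_at q x)" using Suc \<open>q \<noteq> 0\<close> q by (intro Suc(1)) auto
  moreover have "regular (cpoly_at [:- z, 1:] x)"
  proof -
    have "regular ((-1) *\<^sub>C (z *\<^sub>C 1 - x))"
      using Suc(4)[OF z] by (intro regular_scaleC) (simp_all add: in_spectrum_iff)
    also have "(-1) *\<^sub>C (z *\<^sub>C 1 - x) = cpoly_at [:- z, 1:] x"
      by (simp add: cpoly_at_pCons scaleC_minus_left scaleC_one)
    finally show ?thesis .
  qed
  ultimately show ?case unfolding q cpoly_at_mult by (rule regular_mult[rotated])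
qed

lemma poly_at_eq_cpoly_at: "poly_at q x = cpoly_at (map_poly complex_of_real q) x"
  by (simp add: poly_at_def cpoly_at_def degree_map_poly coeff_map_poly scaleR_scaleC)

lemma poly_at_0 [simp]: "poly_at 0 x = 0"
  by (simp add: poly_at_def)

lemma poly_at_pCons: "poly_at (pCons a q) x = a *\<^sub>R 1 + x * poly_at q x"
proof -
  have "map_poly complex_of_real (pCons a q) = pCons (of_real a) (map_poly of_real q)"
    by (rule map_poly_pCons) simp
  then show ?thesis by (simp add: poly_at_eq_cpoly_at cpoly_at_pCons scaleR_scaleC)
qed

lemma poly_at_add: "poly_at (p + q) x = poly_at p x + poly_at q x"
proof -
  have "map_poly complex_of_real (p + q) = map_poly of_real p + map_poly of_real q"
    by (rule poly_eqI) (simp add: coeff_map_poly)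
  then show ?thesis by (simp add: poly_at_eq_cpoly_at cpoly_at_add)
qed

lemma poly_at_smult: "poly_at (smult c p) x = c *\<^sub>R poly_at p x"
proof -
  have "map_poly complex_of_real (smult c p) = smult (of_real c) (map_poly of_real p)"
    by (rule poly_eqI) (simp add: coeff_map_poly)
  then show ?thesis by (simp add: poly_at_eq_cpoly_at cpoly_at_smult scaleR_scaleC)
qed

lemma poly_at_diff: "poly_at (p - q) x = poly_at p x - poly_at q x"
  using poly_at_add[of "p - q" q x] by simp

lemma poly_at_mult: "poly_at (p * q) x = poly_at p x * poly_at q x"
  by (induction p)
     (simp_all add: mult_pCons_left poly_at_add poly_at_smult poly_at_pCons distrib_right mult.assoc)

lemma selfadjoint_poly_at: "selfadjoint x \<Longrightarrow> selfadjoint (poly_at q x)"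
proof -
  assume x: "selfadjoint x"
  have "star (sum f A) = (\<Sum>i\<in>A. star (f i :: 'a))" for f and A :: "nat set"
    by (induction A rule: infinite_finite_induct) (simp_all add: star_add)
  with x show ?thesis
    by (simp add: poly_at_def selfadjoint_def star_scaleR star_power)
qed

lemma poly_map_poly_of_real:
  "poly (map_poly complex_of_real q) (of_real t) = of_real (poly q t)"
  by (induction q) (simp_all add: map_poly_pCons)

text \<open>The norm of \<open>poly_at q x\<close> is attained at a point \<open>t\<close> of its
  spectrum. Then \<open>t - q\<close> evaluated at \<open>x\<close> is singular, so
  \<open>t - q\<close> has a root in the spectrum of \<open>x\<close>, where \<open>q\<close> takes
  the value \<open>t\<close>.\<close>

lemma norm_poly_at_le:
  fixes x :: "'a::cstar_algebra"
  assumes sa: "selfadjoint x" and "0 \<le> c"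
    and bd: "\<And>t. complex_of_real t \<in> spectrum x \<Longrightarrow> \<bar>poly q t\<bar> \<le> c"
  shows "norm (poly_at q x) \<le> c"
proof (cases "poly_at q x = 0")
  case False
  then obtain t where t: "complex_of_real t \<in> spectrum (poly_at q x)" "\<bar>t\<bar> = norm (poly_at q x)"
    using norm_in_spectrum selfadjoint_poly_at[OF sa] by metis
  define p where "p = map_poly complex_of_real ([:t:] - q)"
  have "cpoly_at p x = complex_of_real t *\<^sub>C 1 - poly_at q x"
    unfolding p_def poly_at_eq_cpoly_at[symmetric]
    by (simp add: poly_at_diff poly_at_pCons scaleR_scaleC)
  then have nr: "\<not> regular (cpoly_at p x)" using t(1) by (simp add: in_spectrum_iff)
  \<comment> \<open>If \<open>p = 0\<close>, every number is a root, and a spectral point must be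
    supplied separately.\<close>
  have "1 \<noteq> (0 :: 'a)" using False by (metis mult_1_left mult_zero_left)
  then obtain t0 where "complex_of_real t0 \<in> spectrum x" using spectrum_nonempty[OF sa] by metis
  with regular_cpoly_at[of p x] nr obtain z where z: "poly p z = 0" "z \<in> spectrum x"
    by (cases "p = 0") auto
  then have "z = of_real (Re z)" using selfadjoint_spectrum_real[OF sa] by (simp add: complex_eq_iff)
  then obtain u where u: "z = complex_of_real u" by blast
  with z have "poly q u = t"
    using poly_map_poly_of_real[of "[:t:] - q" u] by (simp add: p_def)
  with bd[of u] z u t(2) show ?thesis by simp
qed (use assms in simp)

section \<open>Continuous functional calculus\<close>

definition rspec :: "'a::cstar_algebra \<Rightarrow> real set" where
  "rspec x = {t. complex_of_real t \<in> spectrum x}"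

lemma rspec_norm_le: "t \<in> rspec x \<Longrightarrow> \<bar>t\<bar> \<le> norm x"
  using spectrum_norm_le[of "complex_of_real t" x] by (simp add: rspec_def)

lemma compact_rspec: "compact (rspec x)"
proof -
  have "closed (complex_of_real -` spectrum x)"
    by (intro continuous_closed_vimage closed_spectrum) (simp add: continuous_intros)
  moreover have "bounded (rspec x)"
    unfolding bounded_iff using rspec_norm_le by fastforce
  ultimately show ?thesis
    by (simp add: compact_eq_bounded_closed rspec_def vimage_def)
qed

lemma spectrum_eq_rspec: "selfadjoint x \<Longrightarrow> spectrum x = complex_of_real ` rspec x"
proof (intro equalityI subsetI)
  fix z assume "selfadjoint x" "z \<in> spectrum x"
  then have "z = complex_of_real (Re z)"
    using selfadjoint_spectrum_real[of x z] by (simp add: complex_eq_iff)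
  with \<open>z \<in> spectrum x\<close> show "z \<in> complex_of_real ` rspec x"
    by (metis image_eqI mem_Collect_eq rspec_def)
qed (auto simp: rspec_def)

lemma positive_cone_iff: "x \<in> positive_cone \<longleftrightarrow> selfadjoint x \<and> (\<forall>t\<in>rspec x. 0 \<le> t)"
  unfolding positive_cone_def by (auto simp: spectrum_eq_rspec less_eq_complex_def)

lemma poly_approx:
  fixes f :: "real \<Rightarrow> real"
  assumes "compact S" "continuous_on S f" "e > 0"
  obtains q where "\<And>t. t \<in> S \<Longrightarrow> \<bar>poly q t - f t\<bar> < e"
proof -
  obtain g where g: "real_polynomial_function g" "\<And>t. t \<in> S \<Longrightarrow> \<bar>f t - g t\<bar> < e"
    using Stone_Weierstrass_real_polynomial_function[OF assms] by blast
  then obtain a n where "g = (\<lambda>t. \<Sum>i\<le>n. a i * t ^ i)"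
    using real_polynomial_function_iff_sum by blast
  then have "poly (\<Sum>i\<le>n. monom (a i) i) t = g t" for t
    by (simp add: poly_sum poly_monom)
  with g(2) show thesis
    by (intro that[of "\<Sum>i\<le>n. monom (a i) i"]) (simp add: abs_minus_commute)
qed

lemma uniform_poly_approx:
  fixes f :: "real \<Rightarrow> real"
  assumes "compact S" "continuous_on S f"
  obtains q where "uniform_limit S (\<lambda>n. poly (q n)) f sequentially"
proof -
  have "\<exists>q. \<forall>t\<in>S. \<bar>poly q t - f t\<bar> < 1 / real (Suc n)" for n
    using poly_approx[OF assms, of "1 / real (Suc n)"] by (metis of_nat_0_less_iff zero_less_Suc zero_less_divide_1_iff)
  then obtain q where q: "\<And>n t. t \<in> S \<Longrightarrow> \<bar>poly (q n) t - f t\<bar> < 1 / real (Suc n)" by metis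
  have "uniform_limit S (\<lambda>n. poly (q n)) f sequentially"
  proof (rule uniform_limitI)
    fix e :: real assume "e > 0"
    then have "\<forall>\<^sub>F n in sequentially. 1 / real (Suc n) < e"
      using order_tendstoD(2)[OF LIMSEQ_inverse_real_of_nat, of e] by (simp add: inverse_eq_divide)
    then show "\<forall>\<^sub>F n in sequentially. \<forall>t\<in>S. dist (poly (q n) t) (f t) < e"
      by eventually_elim (metis q dist_real_def order.strict_trans)
  qed
  then show thesis by (rule that)
qed

lemma poly_at_diff_tendsto_0:
  assumes sa: "selfadjoint x"
    and "uniform_limit (rspec x) (\<lambda>n. poly (q n)) f sequentially"
    and "uniform_limit (rspec x) (\<lambda>n. poly (r n)) f sequentially"
  shows "(\<lambda>n. poly_at (q n) x - poly_at (r n) x) \<longlonglongrightarrow> 0"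
proof (rule tendstoI)
  fix e :: real assume "e > 0"
  then have "e / 3 > 0" by simp
  have "\<forall>\<^sub>F n in sequentially. \<forall>t\<in>rspec x. dist (poly (q n) t) (f t) < e / 3"
    "\<forall>\<^sub>F n in sequentially. \<forall>t\<in>rspec x. dist (poly (r n) t) (f t) < e / 3"
    using assms(2,3) \<open>e / 3 > 0\<close> unfolding uniform_limit_iff by blast+
  then show "\<forall>\<^sub>F n in sequentially. dist (poly_at (q n) x - poly_at (r n) x) 0 < e"
  proof eventually_elim
    case (elim n)
    have "\<bar>poly (q n - r n) t\<bar> \<le> 2 * e / 3" if "t \<in> rspec x" for t
    proof -
      have "\<bar>poly (q n) t - f t\<bar> < e / 3" "\<bar>poly (r n) t - f t\<bar> < e / 3"
        using elim that by (auto simp: dist_real_def)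
      then show ?thesis unfolding poly_diff by linarith
    qed
    then have "norm (poly_at (q n - r n) x) \<le> 2 * e / 3"
      using \<open>e > 0\<close> by (intro norm_poly_at_le[OF sa]) (auto simp: rspec_def)
    with \<open>e > 0\<close> show ?case by (simp add: poly_at_diff)
  qed
qed

lemma poly_at_Cauchy:
  assumes sa: "selfadjoint x"
    and "uniform_limit (rspec x) (\<lambda>n. poly (q n)) f sequentially"
  shows "Cauchy (\<lambda>n. poly_at (q n) x)"
proof (rule metric_CauchyI)
  fix e :: real assume "e > 0"
  then have "e / 3 > 0" by simp
  with assms(2) obtain N where N: "\<And>n t. n \<ge> N \<Longrightarrow> t \<in> rspec x \<Longrightarrow> dist (poly (q n) t) (f t) < e / 3"
    unfolding uniform_limit_iff eventually_sequentially by metis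
  have "dist (poly_at (q m) x) (poly_at (q n) x) < e" if "m \<ge> N" "n \<ge> N" for m n
  proof -
    have "\<bar>poly (q m - q n) t\<bar> \<le> 2 * e / 3" if "t \<in> rspec x" for t
      using N[OF \<open>m \<ge> N\<close> that] N[OF \<open>n \<ge> N\<close> that]
      unfolding dist_real_def poly_diff by linarith
    then have "norm (poly_at (q m - q n) x) \<le> 2 * e / 3"
      using \<open>e > 0\<close> by (intro norm_poly_at_le[OF sa]) (auto simp: rspec_def)
    with \<open>e > 0\<close> show ?thesis by (simp add: poly_at_diff dist_norm)
  qed
  then show "\<exists>M. \<forall>m\<ge>M. \<forall>n\<ge>M. dist (poly_at (q m) x) (poly_at (q n) x) < e" by blast
qed

text \<open>Justifies the definite description in \<open>cfc\<close>: \<open>poly_at_Cauchy\<close>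
  and completeness give a limit, \<open>poly_at_diff_tendsto_0\<close> shows that every
  approximating sequence shares it, and the given sequence \<open>q\<close> makes it unique.\<close>

lemma cfc_tendsto:
  assumes sa: "selfadjoint x" and cont: "continuous_on (rspec x) f"
    and lim: "uniform_limit (rspec x) (\<lambda>n. poly (q n)) f sequentially"
  shows "(\<lambda>n. poly_at (q n) x) \<longlonglongrightarrow> cfc f x"
proof -
  obtain y where y: "(\<lambda>n. poly_at (q n) x) \<longlonglongrightarrow> y"
    using Cauchy_convergent[OF poly_at_Cauchy[OF sa lim]] unfolding convergent_def by blast
  have "cfc f x = y" unfolding cfc_def rspec_def [symmetric]
  proof (rule the_equality)
    show "\<forall>q. uniform_limit (rspec x) (\<lambda>n. poly (q n)) f sequentially
        \<longrightarrow> (\<lambda>n. poly_at (q n) x) \<longlonglongrightarrow> y"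
    proof (intro allI impI)
      fix r assume "uniform_limit (rspec x) (\<lambda>n. poly (r n)) f sequentially"
      from tendsto_add[OF poly_at_diff_tendsto_0[OF sa this lim] y]
      show "(\<lambda>n. poly_at (r n) x) \<longlonglongrightarrow> y" by simp
    qed
    show "z = y" if "\<forall>q. uniform_limit (rspec x) (\<lambda>n. poly (q n)) f sequentially
        \<longrightarrow> (\<lambda>n. poly_at (q n) x) \<longlonglongrightarrow> z" for z
      using that lim y LIMSEQ_unique by blast
  qed
  with y show ?thesis by simp
qed

lemma cfc_approx_seq:
  assumes "selfadjoint x" "continuous_on (rspec x) f"
  obtains q where "uniform_limit (rspec x) (\<lambda>n. poly (q n)) f sequentially"
    "(\<lambda>n. poly_at (q n) x) \<longlonglongrightarrow> cfc f x"
  using uniform_poly_approx[OF compact_rspec assms(2)] cfc_tendsto[OF assms] by metis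

lemma cfc_eqI:
  assumes "selfadjoint x" "continuous_on (rspec x) f"
    "uniform_limit (rspec x) (\<lambda>n. poly (q n)) f sequentially" "(\<lambda>n. poly_at (q n) x) \<longlonglongrightarrow> y"
  shows "cfc f x = y"
  using cfc_tendsto[OF assms(1-3)] assms(4) by (rule LIMSEQ_unique)

lemma cfc_cong:
  assumes "\<And>t. t \<in> rspec x \<Longrightarrow> f t = g t"
  shows "cfc f x = cfc g x"
proof -
  have "uniform_limit (rspec x) h f F \<longleftrightarrow> uniform_limit (rspec x) h g F"
    for h :: "nat \<Rightarrow> real \<Rightarrow> real" and F
    unfolding uniform_limit_iff using assms by simp
  then show ?thesis unfolding cfc_def rspec_def [symmetric] by simp
qed

lemma cfc_poly: "selfadjoint x \<Longrightarrow> cfc (poly q) x = poly_at q x"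
  by (rule cfc_eqI[where q = "\<lambda>_. q"])
     (auto intro: continuous_intros uniform_limit_const simp: uniform_limit_iff)

lemma cfc_const: "selfadjoint x \<Longrightarrow> cfc (\<lambda>_. c) x = c *\<^sub>R 1"
proof -
  assume "selfadjoint x"
  moreover have "poly [:c:] = (\<lambda>_. c)" by auto
  ultimately show ?thesis using cfc_poly[of x "[:c:]"] by (simp add: poly_at_pCons)
qed

lemma cfc_id: "selfadjoint x \<Longrightarrow> cfc (\<lambda>t. t) x = x"
proof -
  assume "selfadjoint x"
  moreover have "poly [:0, 1:] = (\<lambda>t :: real. t)" by auto
  ultimately show ?thesis using cfc_poly[of x "[:0, 1:]"] by (simp add: poly_at_pCons)
qed

lemma cfc_add:
  assumes sa: "selfadjoint x" and f: "continuous_on (rspec x) f" and g: "continuous_on (rspec x) g"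
  shows "cfc (\<lambda>t. f t + g t) x = cfc f x + cfc g x"
proof -
  obtain q where q: "uniform_limit (rspec x) (\<lambda>n. poly (q n)) f sequentially"
    "(\<lambda>n. poly_at (q n) x) \<longlonglongrightarrow> cfc f x" using cfc_approx_seq[OF sa f] .
  obtain r where r: "uniform_limit (rspec x) (\<lambda>n. poly (r n)) g sequentially"
    "(\<lambda>n. poly_at (r n) x) \<longlonglongrightarrow> cfc g x" using cfc_approx_seq[OF sa g] .
  have "poly (p + p') = (\<lambda>t. poly p t + poly p' t)" for p p' :: "real poly" by auto
  then show ?thesis
    by (intro cfc_eqI[where q = "\<lambda>n. q n + r n"])
       (auto simp: poly_at_add sa intro!: continuous_intros f g uniform_limit_add q r tendsto_add)
qed

lemma cfc_mult:
  assumes sa: "selfadjoint x" and f: "continuous_on (rspec x) f" and g: "continuous_on (rspec x) g"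
  shows "cfc (\<lambda>t. f t * g t) x = cfc f x * cfc g x"
proof -
  obtain q where q: "uniform_limit (rspec x) (\<lambda>n. poly (q n)) f sequentially"
    "(\<lambda>n. poly_at (q n) x) \<longlonglongrightarrow> cfc f x" using cfc_approx_seq[OF sa f] .
  obtain r where r: "uniform_limit (rspec x) (\<lambda>n. poly (r n)) g sequentially"
    "(\<lambda>n. poly_at (r n) x) \<longlonglongrightarrow> cfc g x" using cfc_approx_seq[OF sa g] .
  have b: "bounded (f ` rspec x)" "bounded (g ` rspec x)"
    using f g by (auto intro!: compact_imp_bounded compact_continuous_image compact_rspec)
  have "poly (p * p') = (\<lambda>t. poly p t * poly p' t)" for p p' :: "real poly" by auto
  then show ?thesis
    by (intro cfc_eqI[where q = "\<lambda>n. q n * r n"])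
       (auto simp: poly_at_mult sa intro!: continuous_intros f g uniform_lim_mult q r b tendsto_mult)
qed

lemma cfc_scaleR:
  assumes "selfadjoint x" "continuous_on (rspec x) f"
  shows "cfc (\<lambda>t. c * f t) x = c *\<^sub>R cfc f x"
  using cfc_mult[OF assms(1) continuous_on_const assms(2)] by (simp add: cfc_const assms(1))

lemma cfc_diff:
  assumes "selfadjoint x" "continuous_on (rspec x) f" "continuous_on (rspec x) g"
  shows "cfc (\<lambda>t. f t - g t) x = cfc f x - cfc g x"
  using cfc_add[OF assms(1,2), of "\<lambda>t. -1 * g t"] cfc_scaleR[OF assms(1,3), of "-1"] assms(3)
  by (simp add: continuous_on_minus)

lemma selfadjoint_limit:
  assumes "X \<longlonglongrightarrow> x" "\<And>n. selfadjoint (X n)"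
  shows "selfadjoint x"
proof -
  have "(\<lambda>n. star (X n)) \<longlonglongrightarrow> star x"
    by (rule bounded_linear.tendsto[OF bounded_linear_star assms(1)])
  then have "X \<longlonglongrightarrow> star x" using assms(2) by (simp add: selfadjoint_def)
  with assms(1) show ?thesis unfolding selfadjoint_def by (metis LIMSEQ_unique)
qed

lemma selfadjoint_cfc:
  assumes "selfadjoint x" "continuous_on (rspec x) f"
  shows "selfadjoint (cfc f x)"
  using cfc_approx_seq[OF assms] selfadjoint_limit selfadjoint_poly_at[OF assms(1)] by metis

lemma norm_cfc_le:
  assumes sa: "selfadjoint x" and f: "continuous_on (rspec x) f" and "0 \<le> c"
    and bd: "\<And>t. t \<in> rspec x \<Longrightarrow> \<bar>f t\<bar> \<le> c"
  shows "norm (cfc f x) \<le> c"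
proof (rule field_le_epsilon)
  fix e :: real assume "e > 0"
  obtain q where q: "uniform_limit (rspec x) (\<lambda>n. poly (q n)) f sequentially"
    "(\<lambda>n. poly_at (q n) x) \<longlonglongrightarrow> cfc f x" using cfc_approx_seq[OF sa f] .
  have "\<forall>\<^sub>F n in sequentially. \<forall>t\<in>rspec x. dist (poly (q n) t) (f t) < e"
    using q(1) \<open>e > 0\<close> unfolding uniform_limit_iff by blast
  then have "\<forall>\<^sub>F n in sequentially. norm (poly_at (q n) x) \<le> c + e"
  proof eventually_elim
    case (elim n)
    have "\<bar>poly (q n) t\<bar> \<le> c + e" if "t \<in> rspec x" for t
      using bd[OF that] elim that by (force simp: dist_real_def)
    then show ?case using \<open>e > 0\<close> \<open>0 \<le> c\<close> by (intro norm_poly_at_le[OF sa]) (auto simp: rspec_def)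
  qed
  then show "norm (cfc f x) \<le> c + e"
    by (rule tendsto_upperbound[OF tendsto_norm[OF q(2)]]) simp
qed

lemma norm_cfc_diff_le:
  assumes "selfadjoint x" "continuous_on (rspec x) f" "continuous_on (rspec x) g" "0 \<le> c"
    and "\<And>t. t \<in> rspec x \<Longrightarrow> \<bar>f t - g t\<bar> \<le> c"
  shows "norm (cfc f x - cfc g x) \<le> c"
  using assms by (subst cfc_diff [symmetric]) (auto intro!: norm_cfc_le continuous_intros)

text \<open>If \<open>u\<close> is not a value of \<open>f\<close> on the spectrum, then
  \<open>1 / (u - f)\<close> is continuous there and its functional calculus inverts
  \<open>u 1 - cfc f x\<close>.\<close>

lemma rspec_cfc_subset:
  assumes sa: "selfadjoint x" and f: "continuous_on (rspec x) f"
  shows "rspec (cfc f x) \<subseteq> f ` rspec x"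
proof (rule ccontr)
  assume "\<not> ?thesis"
  then obtain u where u: "u \<in> rspec (cfc f x)" "\<And>t. t \<in> rspec x \<Longrightarrow> u \<noteq> f t" by blast
  define g where "g = (\<lambda>t. u - f t)"
  have g: "continuous_on (rspec x) g" unfolding g_def by (intro continuous_intros f)
  then have g': "continuous_on (rspec x) (\<lambda>t. inverse (g t))"
    using u(2) by (intro continuous_intros) (auto simp: g_def)
  have eq: "cfc g x = of_real u *\<^sub>C 1 - cfc f x"
    unfolding g_def by (subst cfc_diff) (auto intro!: f simp: sa cfc_const scaleR_scaleC)
  have "cfc (\<lambda>t. g t * inverse (g t)) x = cfc (\<lambda>_. 1) x"
    using u(2) by (intro cfc_cong) (simp add: g_def)
  then have 1: "cfc g x * cfc (\<lambda>t. inverse (g t)) x = 1"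
    by (simp add: cfc_mult[OF sa g g'] cfc_const[OF sa])
  have "cfc (\<lambda>t. inverse (g t) * g t) x = cfc (\<lambda>_. 1) x"
    using u(2) by (intro cfc_cong) (simp add: g_def)
  then have 2: "cfc (\<lambda>t. inverse (g t)) x * cfc g x = 1"
    by (simp add: cfc_mult[OF sa g' g] cfc_const[OF sa])
  from 1 2 have "regular (cfc g x)" by (rule regularI)
  with u(1) show False by (simp add: rspec_def in_spectrum_iff eq)
qed

text \<open>For polynomial \<open>g\<close> this is additivity and multiplicativity of the calculus;
  the general case follows by uniform approximation of \<open>g\<close> on the image of
  \<open>f\<close>.\<close>

lemma cfc_comp:
  assumes sa: "selfadjoint x" and f: "continuous_on (rspec x) f" and g: "continuous_on (f ` rspec x) g"
  shows "cfc g (cfc f x) = cfc (\<lambda>t. g (f t)) x"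
proof -
  have saf: "selfadjoint (cfc f x)" using selfadjoint_cfc[OF sa f] .
  have gf: "continuous_on (rspec x) (\<lambda>t. g (f t))"
    by (rule continuous_on_compose2[OF g f]) auto
  have pf: "continuous_on (rspec x) (\<lambda>t. poly q (f t))" for q
    by (intro continuous_intros f)
  obtain q where q: "uniform_limit (f ` rspec x) (\<lambda>n. poly (q n)) g sequentially"
    using uniform_poly_approx[OF compact_continuous_image[OF f compact_rspec] g] .
  have poly: "poly_at q (cfc f x) = cfc (\<lambda>t. poly q (f t)) x" for q
  proof (induction q)
    case 0
    show ?case by (simp add: cfc_const sa)
  next
    case (pCons a q)
    have "cfc (\<lambda>t. a + f t * poly q (f t)) x = a *\<^sub>R 1 + cfc f x * cfc (\<lambda>t. poly q (f t)) x"
      by (simp add: cfc_add cfc_mult cfc_const sa f pf continuous_on_mult)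
    then show ?case by (simp add: poly_at_pCons pCons)
  qed
  have "(\<lambda>n. poly_at (q n) (cfc f x)) \<longlonglongrightarrow> cfc (\<lambda>t. g (f t)) x"
  proof (rule LIMSEQ_I)
    fix e :: real assume "e > 0"
    then have "\<forall>\<^sub>F n in sequentially. \<forall>t\<in>f ` rspec x. dist (poly (q n) t) (g t) < e / 2"
      using q half_gt_zero unfolding uniform_limit_iff by blast
    then obtain N where N: "\<And>n t. n \<ge> N \<Longrightarrow> t \<in> rspec x \<Longrightarrow> \<bar>poly (q n) (f t) - g (f t)\<bar> < e / 2"
      unfolding eventually_sequentially dist_real_def by blast
    have "norm (poly_at (q n) (cfc f x) - cfc (\<lambda>t. g (f t)) x) \<le> e / 2" if "n \<ge> N" for n
      unfolding poly using N[OF that] \<open>e > 0\<close>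
      by (intro norm_cfc_diff_le sa pf gf) (auto intro: less_imp_le)
    with \<open>e > 0\<close> show "\<exists>N. \<forall>n\<ge>N. norm (poly_at (q n) (cfc f x) - cfc (\<lambda>t. g (f t)) x) < e"
      by (intro exI[of _ N]) force
  qed
  then show ?thesis
    using rspec_cfc_subset[OF sa f] saf
    by (intro cfc_eqI[where q = q] uniform_limit_on_subset[OF q] continuous_on_subset[OF g])
qed

lemma cfc_nonneg_positive:
  assumes "selfadjoint x" "continuous_on (rspec x) f" "\<And>t. t \<in> rspec x \<Longrightarrow> 0 \<le> f t"
  shows "cfc f x \<in> positive_cone"
  using rspec_cfc_subset[OF assms(1,2)] assms
  by (auto simp: positive_cone_iff selfadjoint_cfc)

lemma tendsto_poly_at:
  "X \<longlonglongrightarrow> x \<Longrightarrow> (\<lambda>n. poly_at q (X n)) \<longlonglongrightarrow> poly_at q x"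
  by (induction q) (auto simp: poly_at_pCons intro!: tendsto_intros)

text \<open>The common compact set \<open>S\<close> allows one polynomial to approximate
  \<open>f\<close> on all the spectra at once, and polynomials are norm continuous.\<close>

lemma tendsto_cfc:
  assumes X: "X \<longlonglongrightarrow> x" and sa: "\<And>n. selfadjoint (X n)"
    and S: "compact S" "\<And>n. rspec (X n) \<subseteq> S" "rspec x \<subseteq> S" and f: "continuous_on S f"
  shows "(\<lambda>n. cfc f (X n)) \<longlonglongrightarrow> cfc f x"
proof (rule LIMSEQ_I)
  fix e :: real assume "e > 0"
  then have e3: "e / 3 > 0" by simp
  obtain q where q: "\<And>t. t \<in> S \<Longrightarrow> \<bar>poly q t - f t\<bar> < e / 3"
    using poly_approx[OF S(1) f e3] by blast
  have approx: "norm (poly_at q y - cfc f y) \<le> e / 3" if "selfadjoint y" "rspec y \<subseteq> S" for y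
  proof -
    have "norm (cfc (poly q) y - cfc f y) \<le> e / 3"
      using that less_imp_le[OF q] less_imp_le[OF e3]
      by (intro norm_cfc_diff_le continuous_intros continuous_on_subset[OF f]) blast+
    then show ?thesis by (simp add: cfc_poly that)
  qed
  obtain N where N: "\<And>n. n \<ge> N \<Longrightarrow> norm (poly_at q (X n) - poly_at q x) < e / 3"
    using LIMSEQ_D[OF tendsto_poly_at[OF X] e3] by blast
  have "norm (cfc f (X n) - cfc f x) < e" if "n \<ge> N" for n
  proof -
    have "cfc f (X n) - cfc f x = (poly_at q (X n) - poly_at q x)
        - (poly_at q (X n) - cfc f (X n)) + (poly_at q x - cfc f x)" by simp
    also have "norm \<dots> \<le> norm (poly_at q (X n) - poly_at q x)
        + norm (poly_at q (X n) - cfc f (X n)) + norm (poly_at q x - cfc f x)"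
      by (rule order_trans[OF norm_triangle_ineq add_right_mono[OF norm_triangle_ineq4]])
    also have "\<dots> < e / 3 + e / 3 + e / 3"
      using N[OF that] approx[OF sa S(2)] approx[OF selfadjoint_limit[OF X sa] S(3)]
      by (intro add_less_le_mono) auto
    finally show ?thesis by simp
  qed
  then show "\<exists>N. \<forall>n\<ge>N. norm (cfc f (X n) - cfc f x) < e" by blast
qed

lemma spectrum_similar:
  assumes T: "T * T' = 1" "T' * T = 1"
  shows "spectrum (T * x * T') = spectrum x"
proof -
  have r: "regular T" "regular T'" using T by (auto intro: regularI)
  have eq: "z *\<^sub>C 1 - T * x * T' = T * (z *\<^sub>C 1 - x) * T'" for z
    using T by (simp add: right_diff_distrib left_diff_distrib mult_scaleC_left mult_scaleC_right)
  have "regular (T * y * T') \<longleftrightarrow> regular y" for y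
  proof
    assume "regular (T * y * T')"
    from regular_mult[OF regular_mult[OF r(2) this] r(1)]
    have "regular (T' * (T * y * T') * T)" .
    also have "T' * (T * y * T') * T = (T' * T) * y * (T' * T)" by (simp add: mult.assoc)
    finally show "regular y" by (simp add: T)
  qed (use r in \<open>auto intro!: regular_mult\<close>)
  then show ?thesis unfolding set_eq_iff in_spectrum_iff eq by simp
qed

text \<open>\<open>T\<close> may be non-unitary. Similarity preserves the spectrum and commutes with
  polynomials, so one approximating sequence serves both elements.\<close>

lemma cfc_similar:
  assumes T: "T * T' = 1" "T' * T = 1"
    and sa: "selfadjoint x" "selfadjoint (T * x * T')" and f: "continuous_on (rspec x) f"
  shows "cfc f (T * x * T') = T * cfc f x * T'"
proof -
  obtain q where q: "uniform_limit (rspec x) (\<lambda>n. poly (q n)) f sequentially"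
    "(\<lambda>n. poly_at (q n) x) \<longlonglongrightarrow> cfc f x" using cfc_approx_seq[OF sa(1) f] .
  have S: "rspec (T * x * T') = rspec x" by (simp add: rspec_def spectrum_similar[OF T])
  have "poly_at p (T * x * T') = T * poly_at p x * T'" for p
  proof (induction p)
    case (pCons a p)
    have "T * x * T' * (T * poly_at p x * T') = T * x * (T' * T) * poly_at p x * T'"
      by (simp only: mult.assoc)
    also have "\<dots> = T * (x * poly_at p x) * T'" by (simp add: T mult.assoc)
    finally show ?case
      unfolding poly_at_pCons pCons.IH using T by (simp add: distrib_left distrib_right)
  qed simp
  then have "(\<lambda>n. poly_at (q n) (T * x * T')) \<longlonglongrightarrow> T * cfc f x * T'"
    by (auto intro!: tendsto_intros q)
  then show ?thesis using q(1) f sa(2) by (intro cfc_eqI[where q = q]) (simp_all add: S)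
qed

section \<open>Midpoint convexity on the real line\<close>

text \<open>Subtracting the chord leaves \<open>h\<close> vanishing at both ends. A positive maximum
  would have a leftmost point \<open>c\<close> in the interior, and midpoint convexity around
  \<open>c\<close> forces the maximum also to the left of \<open>c\<close>.\<close>

lemma midpoint_convex_imp_convex_on:
  fixes g :: "real \<Rightarrow> real"
  assumes cont: "continuous_on UNIV g" and mid: "\<And>u v. 2 * g ((u + v) / 2) \<le> g u + g v"
  shows "convex_on UNIV g"
proof (rule convex_on_linorderI)
  fix t a b :: real
  assume t: "0 < t" "t < 1" and ab: "a < b"
  define s where "s = (g b - g a) / (b - a)"
  define h where "h u = g u - g a - s * (u - a)" for u
  have h0: "h a = 0" "h b = 0" using ab by (simp_all add: h_def s_def)
  have hmid: "2 * h ((u + v) / 2) \<le> h u + h v" for u v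
    using mid[of u v] by (simp add: h_def algebra_simps add_divide_distrib)
  have hcont: "continuous_on {a..b} h"
    unfolding h_def by (intro continuous_intros continuous_on_subset[OF cont]) simp
  obtain m where m: "m \<in> {a..b}" "\<And>u. u \<in> {a..b} \<Longrightarrow> h u \<le> h m"
    using continuous_attains_sup[OF compact_Icc _ hcont] ab by auto
  have "h m \<le> 0"
  proof (rule ccontr)
    assume pos: "\<not> h m \<le> 0"
    define K where "K = {a..b} \<inter> h -` {h m}"
    have "compact K" unfolding K_def
      by (simp add: compact_eq_bounded_closed bounded_Int continuous_on_closed_vimage[THEN iffD1, rule_format, OF _ hcont]
          continuous_closed_preimage hcont)
    moreover have "K \<noteq> {}" using m by (auto simp: K_def)
    ultimately obtain c where c: "c \<in> K" "\<And>u. u \<in> K \<Longrightarrow> c \<le> u"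
      by (metis compact_attains_inf)
    then have hc: "h c = h m" "a \<le> c" "c \<le> b" by (auto simp: K_def)
    with pos h0 have c': "a < c" "c < b" by (metis less_eq_real_def linorder_not_le)+
    define d where "d = min (c - a) (b - c)"
    have d: "d > 0" "a \<le> c - d" "c + d \<le> b" using c' by (auto simp: d_def)
    have "h (c - d) \<noteq> h m" using c(2)[of "c - d"] d hc by (auto simp: K_def)
    moreover have "h (c - d) \<le> h m" "h (c + d) \<le> h m" using m(2) d by auto
    ultimately show False using hmid[of "c - d" "c + d"] hc(1) by simp
  qed
  have "h ((1 - t) * a + t * b) \<le> h m"
  proof (rule m(2))
    have "t * a \<le> t * b" "(1 - t) * a \<le> (1 - t) * b"
      using t ab by (simp_all add: mult_left_mono)
    then show "(1 - t) * a + t * b \<in> {a..b}" by (simp add: algebra_simps)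
  qed
  with \<open>h m \<le> 0\<close> have "h ((1 - t) * a + t * b) \<le> 0" by simp
  moreover have "s * ((1 - t) * a + t * b - a) = t * (g b - g a)"
  proof -
    have "(1 - t) * a + t * b - a = t * (b - a)" by (simp add: algebra_simps)
    then show ?thesis using ab by (simp add: s_def)
  qed
  ultimately show "g ((1 - t) *\<^sub>R a + t *\<^sub>R b) \<le> (1 - t) * g a + t * g b"
    by (simp add: h_def algebra_simps)
qed simp

section \<open>Positive invertible elements and real powers\<close>

text \<open>These are the positive invertible elements. As 0 is off the spectrum,
  \<open>t powr s\<close> is continuous there for every real \<open>s\<close>, so negative powers
  are available.\<close>

definition positive_definite :: "'a::cstar_algebra \<Rightarrow> bool" where
  "positive_definite x \<longleftrightarrow> selfadjoint x \<and> (\<forall>t\<in>rspec x. 0 < t)"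

lemma positive_definite_selfadjoint: "positive_definite x \<Longrightarrow> selfadjoint x"
  by (simp add: positive_definite_def)

lemma positive_definite_positive: "positive_definite x \<Longrightarrow> x \<in> positive_cone"
  by (auto simp: positive_definite_def positive_cone_iff less_imp_le)

lemma zero_in_rspec_iff: "0 \<in> rspec x \<longleftrightarrow> \<not> regular x"
proof -
  have "regular (- x) \<longleftrightarrow> regular x" for x :: 'a
    using regular_scaleC[of x "-1"] regular_scaleC[of "- x" "-1"]
    by (auto simp: scaleC_minus_left scaleC_one)
  then show ?thesis by (simp add: rspec_def in_spectrum_iff)
qed

lemma positive_definite_iff: "positive_definite x \<longleftrightarrow> x \<in> positive_cone \<and> regular x"
  unfolding positive_definite_def positive_cone_iff
  using zero_in_rspec_iff[of x] by (force simp: order_less_le)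

lemma positive_definite_add:
  assumes "x \<in> positive_cone" "e > 0"
  shows "positive_definite (x + e *\<^sub>R 1)"
proof -
  have "t \<in> rspec (x + e *\<^sub>R 1) \<Longrightarrow> t - e \<in> rspec x" for t
    by (simp add: rspec_def spectrum_shift scaleR_scaleC)
  with assms show ?thesis
    by (fastforce simp: positive_definite_def positive_cone_iff
        intro: selfadjoint_add selfadjoint_scaleR selfadjoint_one)
qed

lemma positive_square: "selfadjoint h \<Longrightarrow> h * h \<in> positive_cone"
  using cfc_nonneg_positive[of h "\<lambda>t. t * t"]
  by (simp add: cfc_mult cfc_id continuous_on_id continuous_on_mult)

lemma continuous_on_rspec_powr:
  assumes "x \<in> positive_cone" "s > 0"
  shows "continuous_on (rspec x) (\<lambda>t. t powr s)"
  using assms by (intro continuous_on_powr') (auto simp: positive_cone_iff continuous_on_id)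

lemma cpowr_positive:
  assumes "x \<in> positive_cone" "s > 0"
  shows "cpowr x s \<in> positive_cone"
  unfolding cpowr_def using assms
  by (intro cfc_nonneg_positive continuous_on_rspec_powr) (auto simp: positive_cone_iff)

lemma cpowr_add_positive:
  assumes "x \<in> positive_cone" "s > 0" "u > 0"
  shows "cpowr x (s + u) = cpowr x s * cpowr x u"
  unfolding cpowr_def powr_add using assms
  by (intro cfc_mult continuous_on_rspec_powr) (auto simp: positive_cone_iff)

lemma cpowr_scaleR:
  assumes "x \<in> positive_cone" "s > 0" "c > 0"
  shows "cpowr (c *\<^sub>R x) s = (c powr s) *\<^sub>R cpowr x s"
proof -
  have sa: "selfadjoint x" using assms by (simp add: positive_cone_iff)
  have "continuous_on ((\<lambda>t. c * t) ` rspec x) (\<lambda>t. t powr s)"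
    using assms by (intro continuous_on_powr') (auto simp: continuous_on_id positive_cone_iff)
  then have "cpowr (cfc (\<lambda>t. c * t) x) s = cfc (\<lambda>t. (c * t) powr s) x"
    unfolding cpowr_def by (subst cfc_comp) (auto simp: sa intro!: continuous_intros)
  also have "cfc (\<lambda>t. c * t) x = c *\<^sub>R x"
    by (simp add: cfc_scaleR cfc_id sa continuous_on_id)
  also have "cfc (\<lambda>t. (c * t) powr s) x = cfc (\<lambda>t. c powr s * t powr s) x"
    using assms by (intro cfc_cong powr_mult)
  also have "\<dots> = (c powr s) *\<^sub>R cpowr x s"
    unfolding cpowr_def using assms by (intro cfc_scaleR sa continuous_on_rspec_powr)
  finally show ?thesis .
qed

text \<open>A convergent sequence is bounded, so all spectra lie in one compact interval of
  nonnegative reals.\<close>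

lemma tendsto_cpowr:
  assumes X: "X \<longlonglongrightarrow> x" and pos: "\<And>n. X n \<in> positive_cone" "x \<in> positive_cone" and "s > 0"
  shows "(\<lambda>n. cpowr (X n) s) \<longlonglongrightarrow> cpowr x s"
proof -
  obtain K where K: "\<And>n. norm (X n) \<le> K"
    using convergent_imp_Bseq[OF convergentI[OF X]] unfolding Bseq_def by blast
  have "rspec y \<subseteq> {0..max K (norm x)}" if "y \<in> positive_cone" "norm y \<le> max K (norm x)" for y :: 'a
    using that rspec_norm_le[of _ y] unfolding positive_cone_iff by force
  then show ?thesis
    unfolding cpowr_def using pos K \<open>s > 0\<close>
    by (intro tendsto_cfc[OF X, of "{0..max K (norm x)}"] continuous_on_powr')
       (auto simp: positive_cone_iff continuous_on_id max.coboundedI1)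
qed

context
  fixes x :: "'a::cstar_algebra"
  assumes pd: "positive_definite x"
begin

lemma continuous_on_rspec_powr_pd: "continuous_on (rspec x) (\<lambda>t. t powr s)"
  using pd by (intro continuous_on_powr) (auto simp: positive_definite_def continuous_on_id)

lemma positive_definite_cpowr: "positive_definite (cpowr x s)"
  unfolding positive_definite_def cpowr_def
  using rspec_cfc_subset[OF positive_definite_selfadjoint[OF pd] continuous_on_rspec_powr_pd, of s] pd
  by (fastforce simp: positive_definite_def intro!: selfadjoint_cfc continuous_on_rspec_powr_pd)

lemma selfadjoint_cpowr: "selfadjoint (cpowr x s)"
  by (rule positive_definite_selfadjoint[OF positive_definite_cpowr])

lemma star_cpowr [simp]: "star (cpowr x s) = cpowr x s"
  using selfadjoint_cpowr by (simp add: selfadjoint_def)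

lemma cpowr_add: "cpowr x (s + u) = cpowr x s * cpowr x u"
  unfolding cpowr_def powr_add
  by (intro cfc_mult continuous_on_rspec_powr_pd positive_definite_selfadjoint pd)

lemma cpowr_0: "cpowr x 0 = 1"
proof -
  have "cpowr x 0 = cfc (\<lambda>_. 1) x"
    unfolding cpowr_def using pd by (intro cfc_cong) (auto simp: positive_definite_def)
  then show ?thesis using pd by (simp add: cfc_const positive_definite_def)
qed

lemma cpowr_1: "cpowr x 1 = x"
proof -
  have "cpowr x 1 = cfc (\<lambda>t. t) x"
    unfolding cpowr_def using pd by (intro cfc_cong) (auto simp: positive_definite_def)
  then show ?thesis using pd by (simp add: cfc_id positive_definite_def)
qed

lemma cpowr_cpowr: "cpowr (cpowr x s) u = cpowr x (s * u)"
proof -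
  have "continuous_on ((\<lambda>t. t powr s) ` rspec x) (\<lambda>t. t powr u)"
    using pd by (intro continuous_on_powr) (auto simp: continuous_on_id positive_definite_def)
  then show ?thesis
    using pd unfolding cpowr_def
    by (subst cfc_comp) (auto simp: powr_powr positive_definite_def intro: continuous_on_rspec_powr_pd)
qed

lemma regular_cpowr: "regular (cpowr x s)"
  using positive_definite_cpowr positive_definite_iff by blast

lemma cpowr_similar:
  assumes "T * T' = 1" "T' * T = 1" "selfadjoint (T * x * T')"
  shows "cpowr (T * x * T') s = T * cpowr x s * T'"
  unfolding cpowr_def
  by (rule cfc_similar[OF assms(1,2) positive_definite_selfadjoint[OF pd] assms(3)
        continuous_on_rspec_powr_pd])

text \<open>By compactness of the spectrum, joint continuity of \<open>t powr u\<close> gives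
  uniform closeness in \<open>t\<close> as \<open>u\<close> tends to \<open>s\<close>. It supplies
  the continuity that turns midpoint convexity into convexity.\<close>

lemma continuous_on_cpowr_exponent: "continuous_on UNIV (cpowr x)"
  unfolding continuous_on_iff
proof (intro ballI allI impI)
  fix s e :: real
  assume "e > 0"
  then have "e / 2 > 0" by simp
  have "continuous_on (UNIV \<times> rspec x) (\<lambda>(u, t). t powr u)"
    using pd unfolding case_prod_beta
    by (intro continuous_on_powr continuous_intros) (auto simp: positive_definite_def)
  from continuous_on_prod_compactE[OF this compact_rspec UNIV_I \<open>e / 2 > 0\<close>, of s]
  obtain X where X: "s \<in> X" "open X" "\<forall>u\<in>X \<inter> UNIV. \<forall>t\<in>rspec x. dist (t powr u) (t powr s) \<le> e / 2"
    by (metis (mono_tags, lifting) case_prod_conv)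
  then obtain d where d: "d > 0" "\<And>u. dist u s < d \<Longrightarrow> u \<in> X"
    unfolding open_dist by blast
  have "dist (cpowr x u) (cpowr x s) < e" if "dist u s < d" for u
  proof -
    have "norm (cpowr x u - cpowr x s) \<le> e / 2"
      unfolding cpowr_def using X(3) d(2)[OF that] \<open>e > 0\<close>
      by (intro norm_cfc_diff_le continuous_on_rspec_powr_pd positive_definite_selfadjoint pd)
         (auto simp: dist_real_def)
    with \<open>e > 0\<close> show ?thesis by (simp add: dist_norm)
  qed
  with d(1) show "\<exists>d>0. \<forall>u\<in>UNIV. dist u s < d \<longrightarrow> dist (cpowr x u) (cpowr x s) < e" by blast
qed

end

text \<open>Through this, positivity of the trace yields its reality on selfadjoint elements and its
  boundedness.\<close>

lemma norm_shift_positive: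
  assumes "selfadjoint x"
  shows "norm x *\<^sub>R 1 - x \<in> positive_cone"
proof -
  have "cfc (\<lambda>t. norm x - t) x \<in> positive_cone"
    using rspec_norm_le[of _ x] assms
    by (intro cfc_nonneg_positive continuous_intros) force+
  then show ?thesis using assms by (simp add: cfc_diff cfc_const cfc_id continuous_on_id)
qed

lemma regular_star: "regular T \<Longrightarrow> regular (star T)" for T :: "'a::cstar_algebra"
  unfolding regular_def by (metis star_mult star_one)

section \<open>The trace and positivity of \<open>star x * x\<close>\<close>

locale faithful_trace =
  fixes \<tau> :: "'a::cstar_algebra \<Rightarrow> complex"
  assumes tracial: "tracial_positive_functional \<tau>"
    and faithful: "faithful_functional \<tau>"
begin

definition tr :: "'a \<Rightarrow> real" where "tr x = Re (\<tau> x)"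

lemma \<tau>_add: "\<tau> (x + y) = \<tau> x + \<tau> y"
  and \<tau>_scaleC: "\<tau> (c *\<^sub>C x) = c * \<tau> x"
  and \<tau>_nonneg: "x \<in> positive_cone \<Longrightarrow> 0 \<le> \<tau> x"
  and \<tau>_commute: "\<tau> (x * y) = \<tau> (y * x)"
  using tracial unfolding tracial_positive_functional_def by blast+

lemma \<tau>_diff: "\<tau> (x - y) = \<tau> x - \<tau> y"
  using \<tau>_add[of "x - y" y] by simp

lemma tr_add: "tr (x + y) = tr x + tr y" by (simp add: tr_def \<tau>_add)
lemma tr_diff: "tr (x - y) = tr x - tr y" by (simp add: tr_def \<tau>_diff)
lemma tr_scaleR: "tr (c *\<^sub>R x) = c * tr x" by (simp add: tr_def \<tau>_scaleC scaleR_scaleC)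
lemma tr_commute: "tr (x * y) = tr (y * x)" by (simp add: tr_def \<tau>_commute)
lemma tr_nonneg: "x \<in> positive_cone \<Longrightarrow> 0 \<le> tr x"
  using \<tau>_nonneg by (simp add: tr_def less_eq_complex_def)

text \<open>A selfadjoint \<open>x\<close> is the difference of the positive elements
  \<open>norm x 1\<close> and \<open>norm x 1 - x\<close>, on which \<open>\<tau>\<close> is
  real.\<close>

lemma \<tau>_selfadjoint:
  assumes "selfadjoint x"
  shows "\<tau> x = of_real (tr x)"
proof -
  have "0 \<le> \<tau> (norm x *\<^sub>R 1 - x)" using norm_shift_positive[OF assms] by (rule \<tau>_nonneg)
  moreover have "0 \<le> \<tau> 1" using positive_square[OF selfadjoint_one[where 'a = 'a]] by (simp add: \<tau>_nonneg)
  ultimately show ?thesis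
    by (simp add: tr_def \<tau>_diff scaleR_scaleC \<tau>_scaleC less_eq_complex_def complex_eq_iff)
qed

text \<open>The trace of the selfadjoint element \<open>\<i> (x - star x)\<close> is real, which
  says that \<open>x\<close> and \<open>star x\<close> have traces with the same real part.\<close>

lemma tr_star: "tr (star x) = tr x"
proof -
  have "selfadjoint (\<i> *\<^sub>C (x - star x))"
    by (simp add: selfadjoint_def star_scaleC star_diff star_star scaleC_minus_left
        scaleC_diff_right)
  from \<tau>_selfadjoint[OF this] have "Im (\<i> * (\<tau> x - \<tau> (star x))) = 0"
    by (simp add: \<tau>_scaleC \<tau>_diff)
  then show ?thesis by (simp add: tr_def)
qed

lemma abs_tr_le: "\<bar>tr x\<bar> \<le> norm x * tr 1"
proof -
  have t1: "0 \<le> tr 1" using positive_square[OF selfadjoint_one[where 'a = 'a]] by (simp add: tr_nonneg)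
  have *: "tr y \<le> norm y * tr 1" if "selfadjoint y" for y
    using tr_nonneg[OF norm_shift_positive[OF that]] by (simp add: tr_diff tr_scaleR)
  have **: "2 * tr y \<le> 2 * (norm y * tr 1)" for y
  proof -
    have "selfadjoint (y + star y)" by (simp add: selfadjoint_def star_add star_star add.commute)
    from *[OF this] have "2 * tr y \<le> norm (y + star y) * tr 1" by (simp add: tr_add tr_star)
    also have "\<dots> \<le> (norm y + norm (star y)) * tr 1"
      by (intro mult_right_mono norm_triangle_ineq t1)
    finally show ?thesis by simp
  qed
  have "tr (- x) = - tr x" using tr_scaleR[of "-1" x] by simp
  with **[of x] **[of "- x"] show ?thesis by simp
qed

lemma bounded_linear_tr: "bounded_linear tr"
  using abs_tr_le by (intro bounded_linear_intro[of _ "tr 1"]) (auto simp: tr_add tr_scaleR)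

text \<open>
  The trace cannot distinguish \<open>star x * x\<close> from \<open>x * star x\<close>, and the sum of both is a sum of
  squares of selfadjoint elements.
\<close>

lemma tr_star_mult_nonneg: "0 \<le> tr (star x * x)"
proof -
  define h where "h = x + star x"
  define k where "k = \<i> *\<^sub>C (x - star x)"
  have sa: "selfadjoint h" "selfadjoint k"
    by (simp_all add: selfadjoint_def h_def k_def star_add star_scaleC star_diff star_star
        scaleC_minus_left scaleC_diff_right add.commute)
  have kk: "k * k = - ((x - star x) * (x - star x))"
    by (simp add: k_def scaleC_mult_scaleC scaleC_minus_left scaleC_one)
  have "h * h + k * k = 2 *\<^sub>R (x * star x) + 2 *\<^sub>R (star x * x)"
    unfolding kk by (simp add: h_def distrib_left distrib_right left_diff_distrib right_diff_distrib scaleR_2)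
  then have "tr (h * h) + tr (k * k) = 4 * tr (star x * x)"
    using tr_commute[of x "star x"] by (simp add: tr_add [symmetric] tr_scaleR) (simp add: tr_add tr_scaleR)
  with tr_nonneg[OF positive_square[OF sa(1)]] tr_nonneg[OF positive_square[OF sa(2)]]
  show ?thesis by simp
qed

text \<open>Expand \<open>0 \<le> tr (star w * w)\<close> for \<open>w = star x - y\<close>; both
  cross terms have the trace of \<open>x * y\<close>.\<close>

lemma tr_Cauchy_Schwarz: "2 * tr (x * y) \<le> tr (x * star x) + tr (star y * y)"
proof -
  have "0 \<le> tr (star (star x - y) * (star x - y))" by (rule tr_star_mult_nonneg)
  also have "star (star x - y) * (star x - y) = x * star x - x * y - star (x * y) + star y * y"
    by (simp add: star_diff star_star star_mult left_diff_distrib right_diff_distrib)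
  finally show ?thesis by (simp add: tr_add tr_diff tr_star)
qed

text \<open>
  The negative part \<open>k\<close> of \<open>W = star x * x\<close> satisfies \<open>- k\<^sup>2 = star (x * h) * (x * h)\<close> with
  \<open>h\<^sup>2 = k\<close>, so its trace has both signs and faithfulness gives \<open>k = 0\<close>.
\<close>

lemma star_mult_positive: "star x * x \<in> positive_cone" for x :: 'a
proof -
  define W where "W = star x * x"
  define m :: "real \<Rightarrow> real" where "m = (\<lambda>t. max 0 (- t))"
  define k where "k = cfc m W"
  define h where "h = cfc (\<lambda>t. sqrt (m t)) W"
  have W: "selfadjoint W" by (simp add: W_def selfadjoint_def star_mult star_star)
  have m: "continuous_on S m" for S unfolding m_def by (intro continuous_intros)
  have sm: "continuous_on S (\<lambda>t. sqrt (m t))" for S by (intro continuous_intros m)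
  have sak: "star k = k" and sah: "star h = h"
    using selfadjoint_cfc[OF W m] selfadjoint_cfc[OF W sm] by (simp_all add: k_def h_def selfadjoint_def)
  have "star (x * h) * (x * h) = h * W * h"
    by (simp add: star_mult sah W_def mult.assoc)
  also have "\<dots> = cfc (\<lambda>t. sqrt (m t) * t * sqrt (m t)) W"
    by (simp add: h_def cfc_mult W cfc_id sm continuous_on_mult continuous_on_id)
  also have "\<dots> = cfc (\<lambda>t. - 1 * (m t * m t)) W"
    by (intro cfc_cong) (auto simp: m_def max_def algebra_simps)
  also have "\<dots> = - (k * k)"
    by (subst cfc_scaleR) (auto simp: W cfc_mult m k_def intro!: continuous_intros m)
  finally have "tr (- (k * k)) \<ge> 0" by (metis tr_star_mult_nonneg)
  then have "tr (k * k) \<le> 0" using tr_scaleR[of "-1" "k * k"] by simp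
  moreover have kp: "k * k \<in> positive_cone" using sak by (intro positive_square) (simp add: selfadjoint_def)
  ultimately have "tr (k * k) = 0" using tr_nonneg by (simp add: order_antisym)
  with kp have "\<tau> (k * k) = 0" by (simp add: \<tau>_selfadjoint positive_cone_iff)
  with kp faithful have "k * k = 0" unfolding faithful_functional_def by blast
  then have "k = 0" using cstar_identity[of k] sak by simp
  moreover have "cfc (\<lambda>t. t + m t) W = W + k"
    by (simp add: cfc_add W m continuous_on_id cfc_id k_def)
  moreover have "cfc (\<lambda>t. t + m t) W \<in> positive_cone"
    by (intro cfc_nonneg_positive W continuous_intros m) (simp add: m_def)
  ultimately show ?thesis by (simp add: W_def)
qed

lemma positive_definite_star_mult: "regular T \<Longrightarrow> positive_definite (star T * T)" for T :: 'a
  using star_mult_positive by (simp add: positive_definite_iff regular_mult regular_star)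

end

section \<open>Trace inequalities\<close>

text \<open>The choice \<open>c = x / a\<close> turns the hypothesis into
  \<open>x\<^sup>2 \<le> a * b\<close>. If \<open>a\<close> or \<open>b\<close> vanishes, a suitable
  \<open>c\<close> makes the right-hand side at most \<open>x\<close>, which contradicts
  \<open>0 < x\<close>.\<close>

lemma le_sqrt_if_scaled_mean_le:
  fixes a b x :: real
  assumes nn: "0 \<le> a" "0 \<le> b" "0 \<le> x"
    and le: "\<And>c. 0 < c \<Longrightarrow> 2 * x \<le> c * a + inverse c * b"
  shows "x \<le> sqrt (a * b)"
proof (cases "x = 0")
  case False
  with nn have x: "0 < x" by simp
  have "b \<noteq> 0"
  proof
    assume "b = 0"
    moreover have "x / (a + 1) * a \<le> x" using x nn by (simp add: field_simps)
    ultimately show False using le[of "x / (a + 1)"] x nn by (simp add: add_nonneg_pos)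
  qed
  moreover have "a \<noteq> 0"
  proof
    assume "a = 0"
    moreover have "inverse ((b + 1) / x) * b \<le> x" using x nn by (simp add: field_simps)
    ultimately show False using le[of "(b + 1) / x"] x nn by (simp add: add_nonneg_pos)
  qed
  ultimately have "0 < x / a" "0 < a" using x nn by simp_all
  then have "x\<^sup>2 \<le> a * b" using le[of "x / a"] x by (simp add: field_simps power2_eq_square)
  then show ?thesis by (rule real_le_rsqrt)
qed (use nn in simp)

context faithful_trace begin

lemma tr_rotate: "tr (x * y * z) = tr (y * z * x)"
  using tr_commute[of x "y * z"] by (simp add: mult.assoc)

context
  fixes A B :: 'a
  assumes A: "positive_definite A" and B: "positive_definite B"
begin

text \<open>Split the powers at the midpoint into halves belonging to \<open>u\<close> and
  \<open>v\<close>. After cyclic rotation, Cauchy--Schwarz bounds the trace by the mean of the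
  values at \<open>u\<close> and \<open>v\<close>.\<close>

lemma convex_on_tr_cpowr: "convex_on UNIV (\<lambda>u. tr (cpowr A u * cpowr B (1 - u)))"
proof (rule midpoint_convex_imp_convex_on)
  have "continuous_on UNIV (\<lambda>u. cpowr B (1 - u))"
    by (rule continuous_on_compose2[OF continuous_on_cpowr_exponent[OF B]])
       (auto intro!: continuous_intros)
  then show "continuous_on UNIV (\<lambda>u. tr (cpowr A u * cpowr B (1 - u)))"
    by (intro bounded_linear.continuous_on[OF bounded_linear_tr] continuous_on_mult
        continuous_on_cpowr_exponent A)
next
  fix u v :: real
  define x where "x = cpowr B ((1 - u) / 2) * cpowr A (u / 2)"
  define y where "y = cpowr A (v / 2) * cpowr B ((1 - v) / 2)"
  have "tr (x * y) = tr (cpowr B ((1 - u) / 2) * (cpowr A (u / 2) * cpowr A (v / 2)) * cpowr B ((1 - v) / 2))"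
    by (simp add: x_def y_def mult.assoc)
  also have "\<dots> = tr ((cpowr A (u / 2) * cpowr A (v / 2)) * (cpowr B ((1 - v) / 2) * cpowr B ((1 - u) / 2)))"
    by (subst tr_rotate) (simp add: mult.assoc)
  also have "\<dots> = tr (cpowr A ((u + v) / 2) * cpowr B (1 - (u + v) / 2))"
  proof -
    have "(1 - v) / 2 + (1 - u) / 2 = 1 - (u + v) / 2" "u / 2 + v / 2 = (u + v) / 2"
      by (simp_all add: field_simps)
    then show ?thesis by (simp only: cpowr_add[symmetric] A B)
  qed
  finally have 1: "tr (x * y) = tr (cpowr A ((u + v) / 2) * cpowr B (1 - (u + v) / 2))" .
  have "tr (x * star x) = tr (cpowr B ((1 - u) / 2) * (cpowr A (u / 2) * cpowr A (u / 2)) * cpowr B ((1 - u) / 2))"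
    by (simp add: x_def star_mult mult.assoc A B)
  also have "\<dots> = tr ((cpowr A (u / 2) * cpowr A (u / 2)) * (cpowr B ((1 - u) / 2) * cpowr B ((1 - u) / 2)))"
    by (subst tr_rotate) (simp add: mult.assoc)
  finally have 2: "tr (x * star x) = tr (cpowr A u * cpowr B (1 - u))"
    by (simp add: cpowr_add[symmetric] A B)
  have "tr (star y * y) = tr (cpowr B ((1 - v) / 2) * (cpowr A (v / 2) * cpowr A (v / 2)) * cpowr B ((1 - v) / 2))"
    by (simp add: y_def star_mult mult.assoc A B)
  also have "\<dots> = tr ((cpowr A (v / 2) * cpowr A (v / 2)) * (cpowr B ((1 - v) / 2) * cpowr B ((1 - v) / 2)))"
    by (subst tr_rotate) (simp add: mult.assoc)
  finally have 3: "tr (star y * y) = tr (cpowr A v * cpowr B (1 - v))"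
    by (simp add: cpowr_add[symmetric] A B)
  show "2 * tr (cpowr A ((u + v) / 2) * cpowr B (1 - (u + v) / 2))
      \<le> tr (cpowr A u * cpowr B (1 - u)) + tr (cpowr A v * cpowr B (1 - v))"
    using tr_Cauchy_Schwarz[of x y] by (simp add: 1 2 3)
qed

text \<open>Convexity between 0 and 1, where the function takes the values \<open>tr B\<close> and
  \<open>tr A\<close>.\<close>

lemma tr_young:
  assumes "0 \<le> u" "u \<le> 1"
  shows "tr (cpowr A u * cpowr B (1 - u)) \<le> u * tr A + (1 - u) * tr B"
  using convex_onD[OF convex_on_tr_cpowr, of u 0 1] assms
  by (simp add: cpowr_0 cpowr_1 A B)

text \<open>For \<open>1 \<le> u\<close> the point 1 lies between 0 and \<open>u\<close>; the
  convexity bound on the value at 1 is solved for the value at \<open>u\<close>.\<close>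

lemma tr_young_reverse:
  assumes "1 \<le> u"
  shows "u * tr A + (1 - u) * tr B \<le> tr (cpowr A u * cpowr B (1 - u))"
proof -
  have "tr (cpowr A 1 * cpowr B 0)
      \<le> (1 - 1 / u) * tr (cpowr A 0 * cpowr B 1) + 1 / u * tr (cpowr A u * cpowr B (1 - u))"
    using convex_onD[OF convex_on_tr_cpowr, of "1 / u" 0 u] assms by simp
  then have "tr A \<le> (1 - 1 / u) * tr B + 1 / u * tr (cpowr A u * cpowr B (1 - u))"
    by (simp add: cpowr_0 cpowr_1 A B)
  moreover have "u * ((1 - 1 / u) * x + 1 / u * y) = (u - 1) * x + y" for x y
    using assms by (simp add: field_simps)
  ultimately have "u * tr A \<le> (u - 1) * tr B + tr (cpowr A u * cpowr B (1 - u))"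
    using assms by (metis mult_left_mono order_trans zero_le_one)
  then show ?thesis by (simp add: algebra_simps)
qed

end

text \<open>Reverse Young for \<open>M\<^sup>s\<close> and \<open>C\<^sup>s\<close> with exponent
  \<open>1 / s\<close>. The right-hand side is the tangent at \<open>C\<close> to
  \<open>tr (M\<^sup>s)\<close>, and equality holds for \<open>M = C\<close>.\<close>

lemma tr_cpowr_tangent:
  assumes M: "positive_definite M" and C: "positive_definite C" and s: "0 < s" "s \<le> 1"
  shows "tr (cpowr M s) \<le> s * tr (M * cpowr C (s - 1)) + (1 - s) * tr (cpowr C s)"
proof -
  have "1 / s * tr (cpowr M s) + (1 - 1 / s) * tr (cpowr C s) \<le> tr (M * cpowr C (s - 1))"
    using tr_young_reverse[OF positive_definite_cpowr[OF M, of s] positive_definite_cpowr[OF C, of s], of "1 / s"] s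
    by (simp add: cpowr_cpowr cpowr_1 M C right_diff_distrib)
  moreover have "s * (1 / s * x + (1 - 1 / s) * y) = x - (1 - s) * y" for x y
    using s by (simp add: field_simps)
  ultimately have "tr (cpowr M s) - (1 - s) * tr (cpowr C s) \<le> s * tr (M * cpowr C (s - 1))"
    using s by (metis mult_left_mono less_imp_le)
  then show ?thesis by simp
qed

section \<open>Powers of \<open>star T * T\<close> and \<open>T * star T\<close>\<close>

text \<open>Conjugation by \<open>T\<close> carries \<open>star T * T\<close> to
  \<open>T * star T\<close>, and powers respect similarity.\<close>

lemma cpowr_star_mult_intertwine:
  assumes "regular T"
  shows "T * cpowr (star T * T) s = cpowr (T * star T) s * (T :: 'a)"
proof -
  obtain T' where T': "T * T' = 1" "T' * T = 1" using assms unfolding regular_def by blast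
  have eq: "T * (star T * T) * T' = T * star T" by (simp add: mult.assoc T')
  have "cpowr (T * star T) s = T * cpowr (star T * T) s * T'"
    using cpowr_similar[OF positive_definite_star_mult[OF assms] T'] unfolding eq
    by (simp add: selfadjoint_def star_mult star_star)
  then show ?thesis by (simp add: mult.assoc T')
qed

lemma positive_definite_mult_star: "regular T \<Longrightarrow> positive_definite (T * star T)" for T :: 'a
  using positive_definite_star_mult[of "star T"] by (simp add: regular_star star_star)

lemma tr_cpowr_star_mult:
  assumes "regular T"
  shows "tr (cpowr (T * star T) s) = tr (cpowr (star T * T) s)"
proof -
  obtain T' where T': "T * T' = 1" "T' * T = 1" using assms unfolding regular_def by blast
  have "cpowr (T * star T) s = cpowr (T * star T) s * T * T'" by (simp add: mult.assoc T')
  also have "\<dots> = T * cpowr (star T * T) s * T'"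
    by (simp add: cpowr_star_mult_intertwine[OF assms])
  also have "tr \<dots> = tr (cpowr (star T * T) s)" by (subst tr_rotate) (simp add: mult.assoc T')
  finally show ?thesis .
qed

text \<open>
  With \<open>R = V \<bar>R\<bar>\<close> the polar decomposition, \<open>L = V \<bar>R\<bar>\<^bsup>1/2\<^esup>\<close>, so Cauchy--Schwarz bounds
  \<open>tr (A\<^sup>u R)\<close> by the mean of \<open>tr (A\<^sup>u \<bar>R\<^sup>*\<bar>)\<close> and \<open>tr (A\<^sup>u \<bar>R\<bar>)\<close>.
\<close>

lemma tr_mult_polar:
  assumes A: "positive_definite A" and R: "regular R" and u: "0 \<le> u" "u < 1"
  shows "tr (cpowr A u * R) \<le> u * tr A + (1 - u) * tr (cpowr (R * star R) (1 / (2 * (1 - u))))"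
proof -
  define Q where "Q = star R * R"
  define G where "G = R * star R"
  have Q: "positive_definite Q" and G: "positive_definite G"
    using R by (simp_all add: Q_def G_def positive_definite_star_mult positive_definite_mult_star)
  define L where "L = R * cpowr Q (- 1 / 4)"
  have "L * cpowr Q (1 / 4) = R"
    by (simp add: L_def mult.assoc cpowr_add[symmetric] Q cpowr_0)
  then have "(cpowr A (u / 2) * L) * (cpowr Q (1 / 4) * cpowr A (u / 2))
      = cpowr A (u / 2) * R * cpowr A (u / 2)"
    by (metis mult.assoc)
  also have "tr \<dots> = tr (cpowr A (u / 2) * cpowr A (u / 2) * R)" by (rule tr_rotate [symmetric])
  finally have "tr (cpowr A u * R) = tr ((cpowr A (u / 2) * L) * (cpowr Q (1 / 4) * cpowr A (u / 2)))"
    by (simp add: cpowr_add[symmetric] A)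
  moreover have "tr ((cpowr A (u / 2) * L) * star (cpowr A (u / 2) * L)) = tr (cpowr A u * cpowr G (1 / 2))"
  proof -
    have "L * star L = R * cpowr Q (- 1 / 2) * star R"
    proof -
      have "L * star L = R * (cpowr Q (- 1 / 4) * cpowr Q (- 1 / 4)) * star R"
        by (simp add: L_def star_mult Q mult.assoc)
      then show ?thesis by (simp add: cpowr_add[symmetric] Q)
    qed
    \<comment> \<open>Intertwining moves the power of \<open>Q\<close> to the left of
      \<open>R\<close>, where it becomes a power of \<open>G\<close>.\<close>
    also have "\<dots> = cpowr G (- 1 / 2) * cpowr G 1"
      unfolding Q_def cpowr_star_mult_intertwine[OF R] by (simp add: cpowr_1 G mult.assoc flip: G_def)
    also have "\<dots> = cpowr G (1 / 2)" by (simp add: cpowr_add[symmetric] G)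
    finally have "L * star L = cpowr G (1 / 2)" .
    then have "(cpowr A (u / 2) * L) * star (cpowr A (u / 2) * L) = cpowr A (u / 2) * cpowr G (1 / 2) * cpowr A (u / 2)"
      by (simp add: star_mult A) (metis mult.assoc)
    also have "tr \<dots> = tr (cpowr A (u / 2) * cpowr A (u / 2) * cpowr G (1 / 2))"
      by (rule tr_rotate [symmetric])
    finally show ?thesis by (simp add: cpowr_add[symmetric] A)
  qed
  moreover have "tr (star (cpowr Q (1 / 4) * cpowr A (u / 2)) * (cpowr Q (1 / 4) * cpowr A (u / 2)))
      = tr (cpowr A u * cpowr Q (1 / 2))"
  proof -
    have "star (cpowr Q (1 / 4) * cpowr A (u / 2)) * (cpowr Q (1 / 4) * cpowr A (u / 2))
        = cpowr A (u / 2) * (cpowr Q (1 / 4) * cpowr Q (1 / 4)) * cpowr A (u / 2)"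
      by (simp add: star_mult A Q mult.assoc)
    also have "tr \<dots> = tr (cpowr A (u / 2) * cpowr A (u / 2) * (cpowr Q (1 / 4) * cpowr Q (1 / 4)))"
      by (rule tr_rotate [symmetric])
    finally show ?thesis by (simp add: cpowr_add[symmetric] A Q)
  qed
  ultimately have "2 * tr (cpowr A u * R) \<le> tr (cpowr A u * cpowr G (1 / 2)) + tr (cpowr A u * cpowr Q (1 / 2))"
    using tr_Cauchy_Schwarz[of "cpowr A (u / 2) * L" "cpowr Q (1 / 4) * cpowr A (u / 2)"] by simp
  moreover have "tr (cpowr A u * cpowr W (1 / 2)) \<le> u * tr A + (1 - u) * tr (cpowr W (1 / (2 * (1 - u))))"
    if W: "positive_definite W" for W
  proof -
    \<comment> \<open>Young is applied to the power of \<open>W\<close> whose power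
      \<open>1 - u\<close> is the square root of \<open>W\<close>.\<close>
    have "1 / (2 * (1 - u)) * (1 - u) = 1 / 2" using u by (simp add: field_simps)
    with tr_young[OF A positive_definite_cpowr[OF W, of "1 / (2 * (1 - u))"], of u] u
    show ?thesis by (simp only: cpowr_cpowr[OF W] less_imp_le)
  qed
  note this[OF G] this[OF Q]
  moreover have "tr (cpowr G r) = tr (cpowr Q r)" for r
    unfolding G_def Q_def by (rule tr_cpowr_star_mult[OF R])
  ultimately show ?thesis by (simp add: G_def)
qed

section \<open>The weighted inequality for invertible elements\<close>

definition sandwich :: "'a \<Rightarrow> real \<Rightarrow> 'a \<Rightarrow> real \<Rightarrow> 'a" where
  "sandwich A a B b = cpowr A (a / 2) * cpowr B b * cpowr A (a / 2)"

lemma sandwich_eq_star_mult: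
  assumes "positive_definite A" "positive_definite B"
  shows "sandwich A a B b = star (cpowr B (b / 2) * cpowr A (a / 2)) * (cpowr B (b / 2) * cpowr A (a / 2))"
    and "sandwich A a B b = (cpowr A (a / 2) * cpowr B (b / 2)) * star (cpowr A (a / 2) * cpowr B (b / 2))"
proof -
  have "sandwich A a B b = cpowr A (a / 2) * (cpowr B (b / 2) * cpowr B (b / 2)) * cpowr A (a / 2)"
    by (simp add: sandwich_def cpowr_add[symmetric] assms)
  then show "sandwich A a B b = star (cpowr B (b / 2) * cpowr A (a / 2)) * (cpowr B (b / 2) * cpowr A (a / 2))"
    and "sandwich A a B b = (cpowr A (a / 2) * cpowr B (b / 2)) * star (cpowr A (a / 2) * cpowr B (b / 2))"
    by (simp_all add: star_mult assms mult.assoc)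
qed

lemma positive_definite_sandwich:
  assumes "positive_definite A" "positive_definite B"
  shows "positive_definite (sandwich A a B b)"
  unfolding sandwich_eq_star_mult(1)[OF assms]
  by (intro positive_definite_star_mult regular_mult regular_cpowr assms)

lemma tr_cpowr_sandwich_swap:
  assumes "positive_definite A" "positive_definite B"
  shows "tr (cpowr (sandwich A a B b) s) = tr (cpowr (sandwich B b A a) s)"
  unfolding sandwich_eq_star_mult(1)[OF assms] sandwich_eq_star_mult(2)[OF assms(2,1)]
  by (intro tr_cpowr_star_mult [symmetric] regular_mult regular_cpowr assms)

text \<open>Quantified over all pairs because the duality argument uses it for a pair other than the
  given one.\<close>

definition sandwich_bound :: "real \<Rightarrow> real \<Rightarrow> bool" where
  "sandwich_bound a b \<longleftrightarrow> (\<forall>A B. positive_definite A \<longrightarrow> positive_definite B \<longrightarrow>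
     (a + b) * tr (cpowr (sandwich A a B b) (1 / (a + b))) \<le> a * tr A + b * tr B)"

lemma sandwich_bound_base:
  assumes ab: "1 \<le> a + b" "0 \<le> b" "b \<le> 1"
  shows "sandwich_bound a b"
  unfolding sandwich_bound_def
proof (intro allI impI)
  fix A B :: 'a assume A: "positive_definite A" and B: "positive_definite B"
  define s where "s = 1 / (a + b)"
  have s: "0 < s" "s \<le> 1" "(a + b) * s = 1" using ab by (simp_all add: s_def)
  have "sandwich A a B b * cpowr (cpowr A (a + b)) (s - 1)
      = cpowr A (a / 2) * (cpowr B b * (cpowr A (a / 2) * cpowr A (1 - a - b)))"
    using s(3) by (simp add: sandwich_def cpowr_cpowr A mult.assoc right_diff_distrib diff_diff_eq)
  also have "tr \<dots> = tr (cpowr B b * (cpowr A (a / 2) * cpowr A (1 - a - b) * cpowr A (a / 2)))"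
    by (subst tr_commute) (simp add: mult.assoc)
  also have "cpowr A (a / 2) * cpowr A (1 - a - b) * cpowr A (a / 2) = cpowr A (1 - b)"
    by (simp add: cpowr_add[symmetric] A)
  also have "tr (cpowr B b * cpowr A (1 - b)) \<le> b * tr B + (1 - b) * tr A"
    using ab by (intro tr_young A B)
  finally have 1: "tr (sandwich A a B b * cpowr (cpowr A (a + b)) (s - 1)) \<le> b * tr B + (1 - b) * tr A" .
  have "tr (cpowr (sandwich A a B b) s) \<le> s * tr (sandwich A a B b * cpowr (cpowr A (a + b)) (s - 1))
      + (1 - s) * tr (cpowr (cpowr A (a + b)) s)"
    by (intro tr_cpowr_tangent positive_definite_sandwich positive_definite_cpowr A B s)
  also have "cpowr (cpowr A (a + b)) s = A" using s(3) by (simp add: cpowr_cpowr cpowr_1 A)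
  finally have "tr (cpowr (sandwich A a B b) s) \<le> s * (b * tr B + (1 - b) * tr A) + (1 - s) * tr A"
    using mult_left_mono[OF 1, of s] s by linarith
  from mult_left_mono[OF this, of "a + b"] ab
  have "(a + b) * tr (cpowr (sandwich A a B b) s)
      \<le> (a + b) * s * (b * tr B + (1 - b) * tr A) + (a + b - (a + b) * s) * tr A"
    by (simp add: algebra_simps)
  then show "(a + b) * tr (cpowr (sandwich A a B b) (1 / (a + b))) \<le> a * tr A + b * tr B"
    unfolding s(3) by (simp add: s_def algebra_simps)
qed

text \<open>
  The tangent point is \<open>C = P\<^bsup>1/(1-s)\<^esup>\<close>, chosen such that \<open>C\<^bsup>s-1\<^esup> = P\<^bsup>-1\<^esup>\<close> cancels both outer factors
  and leaves a single power of \<open>B\<close>.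
\<close>

lemma sandwich_bound_step:
  assumes ab: "1 < a + b" and IH: "sandwich_bound a (b - 1)"
  shows "sandwich_bound a b"
  unfolding sandwich_bound_def
proof (intro allI impI)
  fix A B :: 'a assume A: "positive_definite A" and B: "positive_definite B"
  define s where "s = 1 / (a + b)"
  have s: "0 < s" "s < 1" "(a + b) * s = 1" using ab by (simp_all add: s_def)
  define P where "P = sandwich A a B (b - 1)"
  have P: "positive_definite P" unfolding P_def by (intro positive_definite_sandwich A B)
  \<comment> \<open>\<open>Q\<close> is the inverse of \<open>P\<close>, written out so that its
    factors cancel against those of the sandwich.\<close>
  define Q where "Q = cpowr A (- a / 2) * cpowr B (1 - b) * cpowr A (- a / 2)"
  have cancel: "cpowr X r * (cpowr X (- r) * y) = y" if "positive_definite X" for X y :: 'a and r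
    by (simp add: mult.assoc[symmetric] cpowr_add[symmetric] cpowr_0 that)
  have "P * Q = 1"
    using cancel[OF A, of "a / 2"] cancel[OF B, of "b - 1"] cancel[OF A, of "a / 2" 1]
    by (simp add: P_def Q_def sandwich_def mult.assoc)
  then have "cpowr P (- 1) * cpowr P 1 * Q = cpowr P (- 1)"
    by (simp add: cpowr_1 P mult.assoc)
  then have Q: "cpowr P (- 1) = Q" by (simp add: cpowr_add[symmetric] cpowr_0 P)
  have ss: "1 / (1 - s) * (s - 1) = - 1" using s(2) by (simp add: field_simps)
  have "sandwich A a B b * cpowr (cpowr P (1 / (1 - s))) (s - 1) = sandwich A a B b * Q"
    unfolding cpowr_cpowr[OF P] ss Q ..
  also have "\<dots> = cpowr A (a / 2) * (cpowr B b * cpowr B (1 - b)) * cpowr A (- a / 2)"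
    using cancel[OF A, of "a / 2"] by (simp add: sandwich_def Q_def mult.assoc)
  also have "tr \<dots> = tr (B * (cpowr A (- a / 2) * cpowr A (a / 2)))"
    by (subst tr_rotate) (simp add: cpowr_add[symmetric] cpowr_1 B mult.assoc)
  also have "\<dots> = tr B" by (simp add: cpowr_add[symmetric] cpowr_0 A)
  finally have 1: "tr (sandwich A a B b * cpowr (cpowr P (1 / (1 - s))) (s - 1)) = tr B" .
  have "tr (cpowr (sandwich A a B b) s) \<le> s * tr B + (1 - s) * tr (cpowr (cpowr P (1 / (1 - s))) s)"
    unfolding 1 [symmetric] using s
    by (intro tr_cpowr_tangent positive_definite_sandwich positive_definite_cpowr A B P) simp_all
  \<comment> \<open>The exponent \<open>s / (1 - s)\<close> is the reciprocal of
    \<open>a + (b - 1)\<close>, as the induction hypothesis requires.\<close>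
  also have "cpowr (cpowr P (1 / (1 - s))) s = cpowr P (1 / (a + (b - 1)))"
    using ab by (simp add: cpowr_cpowr P s_def field_simps)
  finally have "(a + b) * tr (cpowr (sandwich A a B b) s)
      \<le> (a + b) * (s * tr B + (1 - s) * tr (cpowr P (1 / (a + (b - 1)))))"
    using ab by (intro mult_left_mono) simp_all
  also have "\<dots> = (a + b) * s * tr B + (a + b - (a + b) * s) * tr (cpowr P (1 / (a + (b - 1))))"
    by (simp add: algebra_simps)
  also have "\<dots> = tr B + (a + (b - 1)) * tr (cpowr P (1 / (a + (b - 1))))"
    unfolding s(3) by simp
  also have "\<dots> \<le> tr B + (a * tr A + (b - 1) * tr B)"
    using IH A B unfolding sandwich_bound_def P_def by simp
  finally show "(a + b) * tr (cpowr (sandwich A a B b) (1 / (a + b))) \<le> a * tr A + b * tr B"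
    by (simp add: s_def algebra_simps)
qed

text \<open>Lower \<open>b\<close> by 1 until it is at most 1; \<open>1 \<le> a\<close> keeps the
  exponent sum at least 1 throughout.\<close>

lemma sandwich_bound_ge_1:
  assumes "1 \<le> a" "0 \<le> b" "b \<le> real n + 1"
  shows "sandwich_bound a b"
  using assms(2,3)
proof (induction n arbitrary: b)
  case 0
  then show ?case using assms(1) by (intro sandwich_bound_base) auto
next
  case (Suc n)
  show ?case
  proof (cases "b \<le> 1")
    case True
    then show ?thesis using assms(1) Suc.prems by (intro sandwich_bound_base) auto
  next
    case False
    then have "sandwich_bound a (b - 1)" using Suc.prems by (intro Suc.IH) simp_all
    with assms(1) False show ?thesis by (simp add: sandwich_bound_step)
  qed
qed

text \<open>
  Duality: \<open>M\<^sup>s = A\<^bsup>a/2\<^esup> R\<close>, where \<open>R R\<^sup>*\<close> is a sandwich of \<open>B\<close> and \<open>N\<^sup>s\<close> whose exponents have sum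
  \<open>2 - a \<ge> 1\<close>. Since \<open>N\<^sup>s\<close> and \<open>M\<^sup>s\<close> have the same trace, the resulting bound can be solved for it.
\<close>

lemma sandwich_bound_less_1:
  assumes ab: "0 < a" "0 < b" "a + b < 1"
  shows "sandwich_bound a b"
  unfolding sandwich_bound_def
proof (intro allI impI)
  fix A B :: 'a assume A: "positive_definite A" and B: "positive_definite B"
  define s where "s = 1 / (a + b)"
  \<comment> \<open>Chosen so that \<open>s * c = 2 * s - 1\<close>, the exponent of
    \<open>N\<close> inside \<open>R * star R\<close>.\<close>
  define c where "c = 2 - (a + b)"
  have s: "s * c = 2 * s - 1" using ab by (simp add: s_def c_def field_simps)
  define T where "T = cpowr B (b / 2) * cpowr A (a / 2)"
  have T: "regular T" unfolding T_def by (intro regular_mult regular_cpowr A B)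
  define M where "M = star T * T"
  define N where "N = T * star T"
  have M: "positive_definite M" and N: "positive_definite N"
    using T by (simp_all add: M_def N_def positive_definite_star_mult positive_definite_mult_star)
  have Ms: "sandwich A a B b = M"
    unfolding M_def T_def by (rule sandwich_eq_star_mult(1)[OF A B])
  define R where "R = cpowr B (b / 2) * T * cpowr M (s - 1)"
  have R: "regular R" unfolding R_def by (intro regular_mult regular_cpowr B T M)
  have "cpowr A (a / 2) * R = star T * T * cpowr M (s - 1)"
    by (simp add: R_def T_def star_mult A B mult.assoc)
  also have "\<dots> = cpowr M 1 * cpowr M (s - 1)" by (simp add: cpowr_1 M flip: M_def)
  also have "\<dots> = cpowr M s" by (simp add: cpowr_add[symmetric] M)
  finally have AR: "cpowr A (a / 2) * R = cpowr M s" .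
  have "R * star R = cpowr B (b / 2) * (T * (cpowr M (s - 1) * cpowr M (s - 1)) * star T) * cpowr B (b / 2)"
    by (simp add: R_def star_mult M B mult.assoc)
  also have "T * (cpowr M (s - 1) * cpowr M (s - 1)) * star T = T * cpowr M (2 * s - 2) * star T"
    by (simp add: cpowr_add[symmetric] M)
  also have "\<dots> = cpowr N (2 * s - 2) * cpowr N 1"
    unfolding M_def cpowr_star_mult_intertwine[OF T] by (simp add: cpowr_1 N mult.assoc flip: N_def)
  also have "\<dots> = cpowr (cpowr N s) c"
    by (simp add: cpowr_add[symmetric] cpowr_cpowr N s)
  finally have RR: "R * star R = sandwich B b (cpowr N s) c" by (simp add: sandwich_def)
  define Y where "Y = tr (cpowr (R * star R) (1 / (2 - a)))"
  \<comment> \<open>Here \<open>c > 1\<close>, so the base case requires \<open>b\<close> as the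
    second exponent; the swap lemma then adapts it to the order in
    \<open>R * star R\<close>.\<close>
  have "sandwich_bound c b" using ab by (intro sandwich_bound_base) (simp_all add: c_def)
  then have "(c + b) * tr (cpowr (sandwich (cpowr N s) c B b) (1 / (c + b))) \<le> c * tr (cpowr N s) + b * tr B"
    unfolding sandwich_bound_def using B positive_definite_cpowr[OF N] by blast
  moreover have "c + b = 2 - a" by (simp add: c_def)
  moreover have "tr (cpowr N s) = tr (cpowr M s)"
    unfolding M_def N_def by (rule tr_cpowr_star_mult[OF T])
  ultimately have Y: "(2 - a) * Y \<le> c * tr (cpowr M s) + b * tr B"
    unfolding Y_def RR by (simp add: tr_cpowr_sandwich_swap[OF B positive_definite_cpowr[OF N]])
  \<comment> \<open>For \<open>u = a / 2\<close> the exponent \<open>1 / (2 * (1 - u))\<close> is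
    \<open>1 / (2 - a)\<close>, the one in \<open>Y\<close>.\<close>
  have "tr (cpowr M s) \<le> a / 2 * tr A + (1 - a / 2) * Y"
    using tr_mult_polar[OF A R, of "a / 2"] ab by (simp add: AR Y_def right_diff_distrib)
  then have "2 * tr (cpowr M s) \<le> a * tr A + (2 - a) * Y" by (simp add: field_simps)
  \<comment> \<open>The trace of \<open>M\<^sup>s\<close> stands on both sides, with coefficients 2
    and \<open>c\<close>; the difference \<open>2 - c\<close> is \<open>a + b\<close>.\<close>
  with Y show "(a + b) * tr (cpowr (sandwich A a B b) (1 / (a + b))) \<le> a * tr A + b * tr B"
    by (simp add: Ms s_def c_def algebra_simps)
qed

text \<open>The cases \<open>1 \<le> a\<close>, \<open>1/2 \<le> a \<le> 1\<close> and
  \<open>a < 1/2\<close> fall to the induction, the base case and duality.\<close>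

lemma sandwich_bound_equal:
  assumes "0 < a"
  shows "sandwich_bound a a"
proof -
  obtain n where "a \<le> real n + 1" using real_arch_simple[of a] by (metis add_increasing2 zero_le_one)
  then consider "1 \<le> a" "a \<le> real n + 1" | "1 \<le> a + a" "a \<le> 1" | "a + a < 1" by linarith
  then show ?thesis
    by cases (use assms in \<open>auto intro: sandwich_bound_ge_1 sandwich_bound_base sandwich_bound_less_1\<close>)
qed

section \<open>All positive elements and the geometric mean\<close>

context
  fixes p :: real
  assumes p: "0 < p"
begin

text \<open>The sandwich with both exponents \<open>p / 2\<close>, raised to the reciprocal of their
  sum.\<close>

definition powmean :: "'a \<Rightarrow> 'a \<Rightarrow> 'a" where
  "powmean A B = cpowr (cpowr A (p / 4) * cpowr B (p / 2) * cpowr A (p / 4)) (1 / p)"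

lemma inner_positive:
  fixes A B :: 'a
  assumes "A \<in> positive_cone" "B \<in> positive_cone"
  shows "cpowr A (p / 4) * cpowr B (p / 2) * cpowr A (p / 4) \<in> positive_cone"
proof -
  have "star (cpowr A (p / 4)) = cpowr A (p / 4)" "star (cpowr B (p / 4)) = cpowr B (p / 4)"
    using cpowr_positive[of _ "p / 4"] assms p by (auto simp: positive_cone_iff selfadjoint_def)
  moreover have "cpowr B (p / 2) = cpowr B (p / 4) * cpowr B (p / 4)"
    using cpowr_add_positive[OF assms(2), of "p / 4" "p / 4"] p by simp
  ultimately have "cpowr A (p / 4) * cpowr B (p / 2) * cpowr A (p / 4)
      = star (cpowr B (p / 4) * cpowr A (p / 4)) * (cpowr B (p / 4) * cpowr A (p / 4))"
    by (simp add: star_mult mult.assoc)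
  then show ?thesis by (simp only: star_mult_positive)
qed

lemma powmean_positive:
  "A \<in> positive_cone \<Longrightarrow> B \<in> positive_cone \<Longrightarrow> powmean A B \<in> positive_cone"
  unfolding powmean_def using p by (intro cpowr_positive inner_positive) auto

lemma tr_powmean_le_pd:
  assumes "positive_definite A" "positive_definite B"
  shows "2 * tr (powmean A B) \<le> tr A + tr B"
proof -
  have "p * tr (powmean A B) \<le> p / 2 * tr A + p / 2 * tr B"
    using sandwich_bound_equal[of "p / 2"] p assms
    by (simp add: sandwich_bound_def sandwich_def powmean_def)
  then have "p * (2 * tr (powmean A B)) \<le> p * (tr A + tr B)" by (simp add: algebra_simps)
  with p show ?thesis by simp
qed

text \<open>Adding \<open>1 / (n + 1)\<close> times the unit makes both elements invertible; powers
  with positive exponent and the trace are continuous along these sequences.\<close>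

lemma tr_powmean_le:
  assumes "A \<in> positive_cone" "B \<in> positive_cone"
  shows "2 * tr (powmean A B) \<le> tr A + tr B"
proof -
  define e where "e n = inverse (real (Suc n))" for n
  define X where "X C n = C + e n *\<^sub>R 1" for C :: 'a and n
  have pd: "positive_definite (X C n)" if "C \<in> positive_cone" for C n
    using that unfolding X_def by (intro positive_definite_add) (simp_all add: e_def)
  have "e \<longlonglongrightarrow> 0" unfolding e_def by (rule LIMSEQ_inverse_real_of_nat)
  from tendsto_add[OF tendsto_const tendsto_scaleR[OF this tendsto_const]]
  have lim: "X C \<longlonglongrightarrow> C" for C unfolding X_def by force
  have pos: "X C n \<in> positive_cone" if "C \<in> positive_cone" for C n
    using pd[OF that] by (rule positive_definite_positive)
  have "(\<lambda>n. powmean (X A n) (X B n)) \<longlonglongrightarrow> powmean A B"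
    unfolding powmean_def using assms p
    by (intro tendsto_cpowr tendsto_mult lim pos inner_positive) auto
  then have "(\<lambda>n. 2 * tr (powmean (X A n) (X B n))) \<longlonglongrightarrow> 2 * tr (powmean A B)"
    by (intro tendsto_intros bounded_linear.tendsto[OF bounded_linear_tr])
  moreover have "(\<lambda>n. tr (X A n) + tr (X B n)) \<longlonglongrightarrow> tr A + tr B"
    by (intro tendsto_intros bounded_linear.tendsto[OF bounded_linear_tr] lim)
  ultimately show ?thesis
    by (rule LIMSEQ_le) (use tr_powmean_le_pd[OF pd pd] assms in blast)
qed

lemma scaleR_positive: "x \<in> positive_cone \<Longrightarrow> 0 \<le> c \<Longrightarrow> c *\<^sub>R x \<in> positive_cone" for x :: 'a
  using cfc_nonneg_positive[of x "\<lambda>t. c * t"]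
  by (simp add: positive_cone_iff cfc_scaleR cfc_id continuous_on_mult_left continuous_on_id)

text \<open>The scalar \<open>c powr (p / 2)\<close> collected from the two outer factors cancels
  the one from the middle factor.\<close>

lemma powmean_scale:
  assumes "A \<in> positive_cone" "B \<in> positive_cone" "0 < c"
  shows "powmean (c *\<^sub>R A) (inverse c *\<^sub>R B) = powmean A B"
proof -
  have "c powr (p / 4) * (c powr (p / 4) * inverse c powr (p / 2)) = 1"
  proof -
    have "c powr (p / 4) * (c powr (p / 4) * inverse c powr (p / 2))
        = c powr (p / 4 + p / 4) * inverse c powr (p / 2)"
      unfolding powr_add by simp
    also have "\<dots> = (c * inverse c) powr (p / 2)"
      using assms(3) by (simp add: powr_mult [symmetric])
    finally show ?thesis using assms(3) by simp
  qed
  then show ?thesis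
    unfolding powmean_def using assms p by (simp add: cpowr_scaleR mult_ac)
qed

lemma tr_powmean_le_sqrt:
  assumes "A \<in> positive_cone" "B \<in> positive_cone"
  shows "tr (powmean A B) \<le> sqrt (tr A * tr B)"
proof -
  define x where "x = tr (powmean A B)"
  have nn: "0 \<le> tr A" "0 \<le> tr B" "0 \<le> x"
    using assms by (simp_all add: tr_nonneg x_def powmean_positive)
  have le: "2 * x \<le> c * tr A + inverse c * tr B" if "0 < c" for c
    using tr_powmean_le[of "c *\<^sub>R A" "inverse c *\<^sub>R B"] assms that
    by (simp add: scaleR_positive powmean_scale tr_scaleR x_def)
  from le_sqrt_if_scaled_mean_le[OF nn le] show ?thesis by (simp add: x_def)
qed

end

end

theorem theorem3p3:
  fixes \<tau> :: "'a::cstar_algebra \<Rightarrow> complex"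
    and A B :: 'a
    and p :: real
  assumes "tracial_positive_functional \<tau>"
    and "faithful_functional \<tau>"
    and "p > 0"
    and "A \<in> positive_cone"
    and "B \<in> positive_cone"
  shows "\<tau> (cpowr (cpowr A (p/4) * cpowr B (p/2) * cpowr A (p/4)) (1/p)) \<le> csqrt (\<tau> A * \<tau> B)
       \<and> csqrt (\<tau> A * \<tau> B) \<le> \<tau> ((A + B) /\<^sub>R 2)
       \<and> 0 \<le> \<tau> ((A + B) /\<^sub>R 2
                - cpowr (cpowr A (p/4) * cpowr B (p/2) * cpowr A (p/4)) (1/p))"
proof -
  interpret faithful_trace \<tau> by unfold_locales (fact assms)+
  define Z where "Z = cpowr (cpowr A (p/4) * cpowr B (p/2) * cpowr A (p/4)) (1/p)"
  have Z: "Z = powmean p A B" unfolding Z_def powmean_def[OF assms(3)] ..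
  have sa: "selfadjoint Z" "selfadjoint A" "selfadjoint B"
    using powmean_positive[OF assms(3-5)] assms(4,5) by (simp_all add: Z positive_cone_iff)
  have nn: "0 \<le> tr A" "0 \<le> tr B" using assms(4,5) by (simp_all add: tr_nonneg)
  have 1: "tr Z \<le> sqrt (tr A * tr B)" unfolding Z by (rule tr_powmean_le_sqrt[OF assms(3-5)])
  have 2: "sqrt (tr A * tr B) \<le> (tr A + tr B) / 2" using nn by (rule arith_geo_mean_sqrt)
  \<comment> \<open>All quantities of the claim are embedded reals, so the order on the complex
    numbers reduces to inequalities for \<open>tr\<close>.\<close>
  have mean: "\<tau> ((A + B) /\<^sub>R 2) = of_real ((tr A + tr B) / 2)"
    using sa by (simp add: scaleR_scaleC \<tau>_scaleC \<tau>_add \<tau>_selfadjoint)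
  have sq: "csqrt (\<tau> A * \<tau> B) = of_real (sqrt (tr A * tr B))"
    using nn sa by (simp add: \<tau>_selfadjoint flip: of_real_mult)
  have "\<tau> Z \<le> csqrt (\<tau> A * \<tau> B)" "csqrt (\<tau> A * \<tau> B) \<le> \<tau> ((A + B) /\<^sub>R 2)"
    "0 \<le> \<tau> ((A + B) /\<^sub>R 2 - Z)"
    unfolding \<tau>_diff mean sq using 1 2 sa(1)
    by (simp_all add: \<tau>_selfadjoint less_eq_complex_def)
  then show ?thesis unfolding Z_def by blast
qed

end
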